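(* Let $\beta>0$, let $m$ be a positive integer with $m<n$, let $1-n<a\le0$, let $1<p<(\beta+1)(n+a)/m$, and define $q$ by $$\frac1p-\frac1q=\frac{m}{(\beta+1)(n+a)}.$$ Let $w(x)=|x|^a$ on $\mathbb{R}^n$, let $0\le V\in L^q(w)$, and put $dv(x):=|V(x)|^qw(x)\,dx$. Suppose there is a constant $K>0$ such that $$v(E)\le K\,R^w_{m,p}(E)^{\frac qp}\qquad\text{for all measurable } E\subseteq\mathbb{R}^n.$$ Then there exists $C>0$ such that for any $\epsilon>0$ and any $\phi\in C_c^\infty(\mathbb{R}^n)$, $$\|V\phi\|_{L^p(w)}^p\le\epsilon\,\|\nabla^m\phi\|_{L^p(w)}^p+C\epsilon^{-\beta}\|\phi\|_{L^p(w)}^p.$$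
   Context: $\|f\|_{L^p(w)}^p=\int_{\mathbb{R}^n}|f|^pw\,dx$. $\nabla^m\phi$ is the collection of all partial derivatives of $\phi$ of order $m$, with $|\nabla^m\phi|$ its Euclidean norm. The weighted Riesz capacity is $$R^w_{m,p}(E):=\inf\Big\{\int_{\mathbb{R}^n}f(x)^pw(x)\,dx:\ 0\le f\in L^p(w),\ I_mf\ge1\text{ on }E\Big\},\qquad I_mf(x):=\int_{\mathbb{R}^n}|f(y)||x-y|^{m-n}\,dy.$$ *)

theory Defs
  imports "HOL-Analysis.Analysis"
begin

text \<open>Only used for \<open>r > 0\<close>, where \<open>\<infinity>\<^sup>r = \<infinity>\<close>.\<close>

definition ennreal_powr :: "ennreal \<Rightarrow> real \<Rightarrow> ennreal" where
  "ennreal_powr x r = (if x = \<infinity> then \<infinity> else ennreal (enn2real x powr r))"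

text \<open>The \<open>p\<close>-th power of the norm of \<open>L\<^sup>p(w)\<close>, as an extended nonnegative real.\<close>

definition Lp_pow :: "real \<Rightarrow> (real^'n \<Rightarrow> real) \<Rightarrow> (real^'n \<Rightarrow> real) \<Rightarrow> ennreal" where
  "Lp_pow p w f = (\<integral>\<^sup>+x. ennreal (\<bar>f x\<bar> powr p * w x) \<partial>lebesgue)"

definition Lp_space :: "real \<Rightarrow> (real^'n \<Rightarrow> real) \<Rightarrow> (real^'n \<Rightarrow> real) set" where
  "Lp_space p w = {f \<in> borel_measurable lebesgue. Lp_pow p w f < \<infinity>}"

text \<open>Recall \<open>0 powr s = 0\<close> for every \<open>s\<close>; here and in the weight below this affects
  the integrands only on a null set.\<close>

definition riesz_potential :: "nat \<Rightarrow> (real^'n \<Rightarrow> real) \<Rightarrow> real^'n \<Rightarrow> ennreal" where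
  "riesz_potential m f x =
     (\<integral>\<^sup>+y. ennreal (\<bar>f y\<bar> * norm (x - y) powr (real m - real CARD('n))) \<partial>lebesgue)"

definition riesz_capacity ::
    "nat \<Rightarrow> real \<Rightarrow> (real^'n \<Rightarrow> real) \<Rightarrow> (real^'n) set \<Rightarrow> ennreal" where
  "riesz_capacity m p w E =
     Inf {Lp_pow p w f | f. f \<in> Lp_space p w \<and> (AE x in lebesgue. 0 \<le> f x) \<and>
                            (\<forall>x\<in>E. 1 \<le> riesz_potential m f x)}"

definition power_weight :: "real \<Rightarrow> real^'n \<Rightarrow> real" where
  "power_weight a x = norm x powr a"

definition partial :: "'n \<Rightarrow> (real^'n \<Rightarrow> real) \<Rightarrow> real^'n \<Rightarrow> real" where
  "partial i f x = deriv (\<lambda>t. f (x + t *\<^sub>R axis i 1)) 0"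

fun partials :: "'n list \<Rightarrow> (real^'n \<Rightarrow> real) \<Rightarrow> real^'n \<Rightarrow> real" where
  "partials [] f = f"
| "partials (i # is) f = partial i (partials is f)"

text \<open>\<open>C\<^sub>c\<^sup>\<infinity>\<close>. Total differentiability of every iterated partial derivative also gives the
  existence of the next partial derivatives, so that \<open>deriv\<close> is never taken at a point where
  the derivative does not exist.\<close>

definition smooth_compact_support :: "(real^'n \<Rightarrow> real) set" where
  "smooth_compact_support =
     {\<phi>. (\<forall>is x. partials is \<phi> differentiable (at x)) \<and> compact (closure {x. \<phi> x \<noteq> 0})}"

definition multi_indices :: "nat \<Rightarrow> ('n::finite \<Rightarrow> nat) set" where
  "multi_indices m = {\<alpha>. (\<Sum>i\<in>UNIV. \<alpha> i) = m}"

lemma finite_multi_indices: "finite (multi_indices m :: ('n::finite \<Rightarrow> nat) set)"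
proof (rule finite_subset)
  show "multi_indices m \<subseteq> (\<Pi>\<^sub>E i\<in>(UNIV::'n set). {..m})"
    by (auto simp: multi_indices_def intro: member_le_sum)
qed (auto intro: finite_PiE)

text \<open>The list fixes an order of differentiation, which is immaterial for smooth functions.\<close>

definition multi_partial :: "('n \<Rightarrow> nat) \<Rightarrow> (real^'n \<Rightarrow> real) \<Rightarrow> real^'n \<Rightarrow> real" where
  "multi_partial \<alpha> = partials (SOME is. \<forall>i. count_list is i = \<alpha> i)"

lemma ex_list_multi_index: "\<exists>is. \<forall>i. count_list is i = (\<alpha> :: 'n::finite \<Rightarrow> nat) i"
proof -
  obtain "is" where "mset is = Abs_multiset \<alpha>" using ex_mset by blast
  then have "count (mset is) = \<alpha>" by simp
  then show ?thesis by (metis count_mset)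
qed

definition gradient_norm :: "nat \<Rightarrow> (real^'n \<Rightarrow> real) \<Rightarrow> real^'n \<Rightarrow> real" where
  "gradient_norm m \<phi> x = sqrt (\<Sum>\<alpha>\<in>multi_indices m. (multi_partial \<alpha> \<phi> x)\<^sup>2)"

end

theory Submission
  imports Defs
begin

text \<open>Write \<open>n\<close> for the dimension, \<open>N = n + a\<close>, and let \<open>B = B(z, r)\<close> and \<open>B\<^sup>* = B(z, (2m+1)r)\<close> be concentric balls.
The inequality is proved on each ball and then integrated over all centres \<open>z\<close>; the radius is
a function of \<open>\<epsilon>\<close>. The local inequality is
\<open>\<integral>\<^sub>B |V\<phi>|\<^sup>p w \<le> C \<omega> powr (1 - p/q) * (\<integral>\<^bsub>B*\<^esub> |\<nabla>\<^sup>m\<phi>|\<^sup>p w + r powr (-mp) * \<integral>\<^bsub>B*\<^esub> |\<phi>|\<^sup>p w)\<close>, where \<open>\<omega>\<close> is comparable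
to the \<open>w\<close>-measure of \<open>B\<^sup>*\<close>. Since \<open>a \<le> 0\<close>, \<open>\<omega>\<close> is at most a multiple of \<open>r powr N\<close>, and the relation between \<open>p\<close> and \<open>q\<close>
gives \<open>N(1 - p/q) = mp/(\<beta>+1)\<close>. Choosing \<open>r powr (mp/(\<beta>+1))\<close> proportional to \<open>\<epsilon>\<close> turns the two
coefficients into \<open>\<epsilon>\<close> and a multiple of \<open>\<epsilon> powr (-\<beta>)\<close>.

Two ingredients give the local inequality. The first is a Sobolev representation on balls
(\<open>local_sobolev_representation\<close>): for \<open>x\<close> in \<open>B\<close>, \<open>|\<phi>(x)|\<close> is bounded by the mean of \<open>|\<phi>|\<close> over \<open>B\<^sup>*\<close>
plus the Riesz potential of \<open>|\<nabla>\<^sup>m\<phi>|\<close> restricted to \<open>B\<^sup>*\<close>. It comes from averaging an \<open>m\<close>-th finite difference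
over directions, so that no derivatives of intermediate order appear. The weight enters through its
\<open>A\<^sub>1\<close> property, which bounds the mean of \<open>|\<phi>|\<close> by \<open>(\<omega>\<^sup>-\<^sup>1 \<integral>\<^bsub>B*\<^esub> |\<phi>|\<^sup>p w)\<close> to the power \<open>1/p\<close>
(\<open>nn_integral_ball_le_powr_mean\<close>).

The second is the capacity hypothesis, used as a weak-type bound: the set where a
potential \<open>I\<^sub>m f\<close> is at least \<open>t\<close> has capacity at most \<open>t powr (-p) * \<integral> f\<^sup>p w\<close>. Let \<open>\<Lambda>\<close> be a large multiple of
\<open>(\<omega>\<^sup>-\<^sup>1 \<integral>\<^bsub>B*\<^esub> |\<phi>|\<^sup>p w)\<close> to the power \<open>1/p\<close>. Where \<open>|\<phi>| \<le> \<Lambda>\<close>, the capacity of \<open>B\<close> itself suffices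
(\<open>ball_trace_estimate\<close>). On the level set where \<open>|\<phi>| > 2\<^sup>k \<Lambda>\<close> the mean accounts for at most half of \<open>|\<phi>|\<close>, so the potential is
large and the \<open>v\<close>-measure is controlled by the capacity, while the \<open>w\<close>-measure is controlled by
Chebyshev's inequality for \<open>|\<phi>|\<^sup>p\<close>. Hoelder's inequality with exponents \<open>q/p\<close> and its conjugate multiplies the
two bounds and leaves a geometric series in \<open>k\<close>, because \<open>p < q\<close>; so the weak-type bound suffices.\<close>

section \<open>Forward differences on the line\<close>

fun fdiff :: "nat \<Rightarrow> real \<Rightarrow> (real \<Rightarrow> real) \<Rightarrow> real \<Rightarrow> real" where
  "fdiff 0 s g u = g u"
| "fdiff (Suc k) s g u = fdiff k s g (u + s) - fdiff k s g u"

lemma abs_fdiff_le: "\<bar>fdiff k s g u\<bar> \<le> 2 ^ k * (\<Sum>j\<le>k. \<bar>g (u + real j * s)\<bar>)"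
proof (induction k arbitrary: u)
  case (Suc k)
  let ?S = "\<Sum>j\<le>Suc k. \<bar>g (u + real j * s)\<bar>"
  have "(\<Sum>j\<le>k. \<bar>g (u + s + real j * s)\<bar>) = (\<Sum>j\<in>{1..Suc k}. \<bar>g (u + real j * s)\<bar>)"
    by (simp only: atMost_atLeast0 One_nat_def sum.shift_bounds_cl_Suc_ivl) (simp add: algebra_simps)
  also have "\<dots> \<le> ?S"
    by (rule sum_mono2) auto
  finally have 1: "(\<Sum>j\<le>k. \<bar>g (u + s + real j * s)\<bar>) \<le> ?S" .
  have 2: "(\<Sum>j\<le>k. \<bar>g (u + real j * s)\<bar>) \<le> ?S"
    by (rule sum_mono2) auto
  have "\<bar>fdiff (Suc k) s g u\<bar> \<le> \<bar>fdiff k s g (u + s)\<bar> + \<bar>fdiff k s g u\<bar>"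
    by simp
  also have "\<dots> \<le> 2 ^ k * ?S + 2 ^ k * ?S"
    using Suc.IH[of "u + s"] Suc.IH[of u] 1 2
    by (intro add_mono) (auto intro: order_trans mult_left_mono)
  finally show ?case by simp
qed simp

text \<open>Unfolding the difference one order at a time, \<open>g u\<close> is compared with its \<open>k\<close>-th difference; each
order costs one difference based at the shifted point \<open>u + s\<close>, which only involves later sample points.
The sum therefore starts at \<open>j = 1\<close>, away from \<open>u\<close>.\<close>

lemma abs_le_fdiff:
  "\<bar>g u\<bar> \<le> \<bar>fdiff k s g u\<bar> + 2 ^ k * (\<Sum>j\<in>{1..k}. \<bar>g (u + real j * s)\<bar>)"
proof (induction k)
  case (Suc k)
  let ?S = "\<lambda>k. \<Sum>j\<in>{1..k}. \<bar>g (u + real j * s)\<bar>"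
  have "(\<Sum>j\<le>k. \<bar>g (u + s + real j * s)\<bar>) = ?S (Suc k)"
    by (simp only: atMost_atLeast0 One_nat_def sum.shift_bounds_cl_Suc_ivl) (simp add: algebra_simps)
  then have "\<bar>fdiff k s g (u + s)\<bar> \<le> 2 ^ k * ?S (Suc k)"
    using abs_fdiff_le[of k s g "u + s"] by simp
  moreover have "?S k \<le> ?S (Suc k)"
    by (rule sum_mono2) auto
  then have "2 ^ k * ?S k \<le> 2 ^ k * ?S (Suc k)" by (intro mult_left_mono) auto
  moreover have "2 ^ Suc k * ?S (Suc k) = 2 ^ k * ?S (Suc k) + 2 ^ k * ?S (Suc k)" by simp
  ultimately show ?case using Suc.IH unfolding fdiff.simps by linarith
qed simp

lemma fdiff_has_derivative:
  assumes "\<And>t. (g has_real_derivative g' t) (at t)"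
  shows "(fdiff k s g has_real_derivative fdiff k s g' t) (at t)"
proof (induction k arbitrary: t)
  case 0
  have "fdiff 0 s g = g" by auto
  then show ?case using assms by simp
next
  case (Suc k)
  have "fdiff (Suc k) s g = (\<lambda>u. fdiff k s g (u + s) - fdiff k s g u)" by auto
  moreover have "((\<lambda>u. fdiff k s g (u + s)) has_real_derivative fdiff k s g' (t + s)) (at t)"
    using Suc.IH[of "t + s"] by (simp add: DERIV_shift)
  ultimately show ?case by (simp add: Suc.IH DERIV_diff)
qed

lemma abs_diff_le_nn_integral:
  fixes g g' :: "real \<Rightarrow> real"
  assumes d: "\<And>t. (g has_real_derivative g' t) (at t)" and c: "continuous_on UNIV g'" and s: "s \<ge> 0"
  shows "ennreal \<bar>g (u + s) - g u\<bar> \<le> (\<integral>\<^sup>+t. indicator {0<..<s} t * ennreal \<bar>g' (u + t)\<bar> \<partial>lborel)"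
proof -
  have c': "continuous_on {0..s} (\<lambda>t. g' (u + t))"
    by (intro continuous_on_compose2[OF c]) (auto intro!: continuous_intros)
  have d': "((\<lambda>t. g (u + t)) has_real_derivative g' (u + t)) (at t within {0..s})" for t
    using d[of "u + t"] by (auto simp: DERIV_shift add.commute intro: has_field_derivative_at_within)
  have 1: "((\<lambda>t. g' (u + t)) has_integral (g (u + s) - g (u + 0))) {0..s}"
    using s d' by (intro fundamental_theorem_of_calculus)
       (auto simp: has_real_derivative_iff_has_vector_derivative[symmetric])
  have int: "(\<lambda>t. \<bar>g' (u + t)\<bar>) integrable_on {0..s}"
    by (intro integrable_continuous_real continuous_intros c')
  have "\<bar>g (u + s) - g u\<bar> \<le> integral {0..s} (\<lambda>t. \<bar>g' (u + t)\<bar>)"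
    using integral_norm_bound_integral[of "\<lambda>t. g' (u + t)" "{0..s}" "\<lambda>t. \<bar>g' (u + t)\<bar>"] 1 int
    by (auto simp: has_integral_iff)
  then have "ennreal \<bar>g (u + s) - g u\<bar> \<le> ennreal (integral {0..s} (\<lambda>t. \<bar>g' (u + t)\<bar>))"
    by (rule ennreal_leI)
  also have "\<dots> = (\<integral>\<^sup>+t. indicator {0..s} t * \<bar>g' (u + t)\<bar> \<partial>lborel)"
    using nn_integral_has_integral_lebesgue[of "{0..s}" "\<lambda>t. \<bar>g' (u + t)\<bar>"] int
    by (auto simp: has_integral_integral)
  also have "\<dots> = (\<integral>\<^sup>+t. indicator {0<..<s} t * ennreal \<bar>g' (u + t)\<bar> \<partial>lborel)"
  proof (intro nn_integral_cong_AE)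
    have "AE t in lborel. t \<noteq> 0 \<and> t \<noteq> s"
      using AE_lborel_singleton[of 0] AE_lborel_singleton[of s] by eventually_elim auto
    then show "AE t in lborel. ennreal (indicator {0..s} t * \<bar>g' (u + t)\<bar>) =
       indicator {0<..<s} t * ennreal \<bar>g' (u + t)\<bar>"
      by eventually_elim (auto simp: indicator_def)
  qed
  finally show ?thesis .
qed

text \<open>The weight \<open>t\<^sup>k\<close>, which vanishes at the base point, is what later produces the Riesz kernel.
By induction the difference of order \<open>k + 2\<close> is an integral over a shift \<open>\<tau>\<close> of differences of the derivative.
After substituting \<open>r = \<tau> + t\<close>, the factor \<open>t\<^sup>k\<close> is at most \<open>r\<^sup>k\<close>, and the shifts \<open>\<tau>\<close> that can
lead to a given \<open>r\<close> lie in \<open>(0, r)\<close>, which supplies one more factor \<open>r\<close>.\<close>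

lemma fdiff_le_nn_integral:
  fixes G :: "nat \<Rightarrow> real \<Rightarrow> real"
  assumes d: "\<And>k t. (G k has_real_derivative G (Suc k) t) (at t)" and s: "s \<ge> 0"
  shows "ennreal \<bar>fdiff (Suc k) s (G i) u\<bar> \<le>
    (\<integral>\<^sup>+t. indicator {0<..<real (Suc k) * s} t * ennreal (t ^ k * \<bar>G (i + Suc k) (u + t)\<bar>) \<partial>lborel)"
proof (induction k arbitrary: i u)
  have cG: "continuous_on UNIV (G k)" for k
    using d by (meson DERIV_continuous_on has_field_derivative_at_within)
  {
    case 0
    show ?case using abs_diff_le_nn_integral[OF d cG s, of i u] by simp
  next
    case (Suc k)
    have [measurable]: "G k \<in> borel_measurable borel" for k
      by (rule borel_measurable_continuous_onI[OF cG])
    let ?g = "G (i + Suc (Suc k))"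
    have cf: "continuous_on UNIV (fdiff j s (G i))" for i j
      using fdiff_has_derivative[OF d] by (meson DERIV_continuous_on has_field_derivative_at_within)
    have "ennreal \<bar>fdiff (Suc (Suc k)) s (G i) u\<bar> \<le>
        (\<integral>\<^sup>+\<tau>. indicator {0<..<s} \<tau> * ennreal \<bar>fdiff (Suc k) s (G (Suc i)) (u + \<tau>)\<bar> \<partial>lborel)"
      using abs_diff_le_nn_integral[OF fdiff_has_derivative[OF d] cf s, of "Suc k" i u] by simp
    also have "\<dots> \<le> (\<integral>\<^sup>+\<tau>. indicator {0<..<s} \<tau> *
        (\<integral>\<^sup>+t. indicator {0<..<real (Suc k) * s} t * ennreal (t ^ k * \<bar>?g (u + \<tau> + t)\<bar>) \<partial>lborel) \<partial>lborel)"
      using Suc.IH[of "Suc i"] by (intro nn_integral_mono mult_left_mono) simp_all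
    also have "\<dots> = (\<integral>\<^sup>+\<tau>. indicator {0<..<s} \<tau> *
        (\<integral>\<^sup>+r. indicator {0<..<real (Suc k) * s} (r - \<tau>) * ennreal ((r - \<tau>) ^ k * \<bar>?g (u + r)\<bar>) \<partial>lborel) \<partial>lborel)"
    proof -
      have "(\<integral>\<^sup>+t. indicator {0<..<real (Suc k) * s} t * ennreal (t ^ k * \<bar>?g (u + \<tau> + t)\<bar>) \<partial>lborel)
        = (\<integral>\<^sup>+r. indicator {0<..<real (Suc k) * s} (r - \<tau>) * ennreal ((r - \<tau>) ^ k * \<bar>?g (u + r)\<bar>) \<partial>lborel)" for \<tau>
        by (subst nn_integral_real_affine[where c=1 and t="-\<tau>"]) (auto simp: algebra_simps)
      then show ?thesis by simp
    qed
    also have "\<dots> = (\<integral>\<^sup>+\<tau>. (\<integral>\<^sup>+r. indicator {0<..<s} \<tau> *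
        (indicator {0<..<real (Suc k) * s} (r - \<tau>) * ennreal ((r - \<tau>) ^ k * \<bar>?g (u + r)\<bar>)) \<partial>lborel) \<partial>lborel)"
      by (intro nn_integral_cong nn_integral_cmult[symmetric]) measurable
    also have "\<dots> = (\<integral>\<^sup>+r. (\<integral>\<^sup>+\<tau>. indicator {0<..<s} \<tau> *
        (indicator {0<..<real (Suc k) * s} (r - \<tau>) * ennreal ((r - \<tau>) ^ k * \<bar>?g (u + r)\<bar>)) \<partial>lborel) \<partial>lborel)"
      by (rule lborel_pair.Fubini'[symmetric]) measurable
    also have "\<dots> \<le> (\<integral>\<^sup>+r. (\<integral>\<^sup>+\<tau>. indicator {0<..<real (Suc (Suc k)) * s} r *
        ennreal (r ^ k * \<bar>?g (u + r)\<bar>) * indicator {0<..<r} \<tau> \<partial>lborel) \<partial>lborel)"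
    proof (intro nn_integral_mono)
      fix r \<tau> :: real
      show "indicator {0<..<s} \<tau> *
        (indicator {0<..<real (Suc k) * s} (r - \<tau>) * ennreal ((r - \<tau>) ^ k * \<bar>?g (u + r)\<bar>))
        \<le> indicator {0<..<real (Suc (Suc k)) * s} r *
        ennreal (r ^ k * \<bar>?g (u + r)\<bar>) * indicator {0<..<r} \<tau>"
      proof (cases "0 < \<tau> \<and> \<tau> < s \<and> 0 < r - \<tau> \<and> r - \<tau> < real (Suc k) * s")
        case True
        then have "r < real (Suc (Suc k)) * s" by (auto simp: algebra_simps)
        with True show ?thesis
          by (auto simp: indicator_def intro!: ennreal_leI mult_right_mono power_mono)
      qed (auto simp: indicator_def)
    qed
    also have "\<dots> = (\<integral>\<^sup>+r. indicator {0<..<real (Suc (Suc k)) * s} r *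
        ennreal (r ^ Suc k * \<bar>?g (u + r)\<bar>) \<partial>lborel)"
    proof (intro nn_integral_cong)
      fix r :: real
      have "(\<integral>\<^sup>+\<tau>. indicator {0<..<real (Suc (Suc k)) * s} r *
        ennreal (r ^ k * \<bar>?g (u + r)\<bar>) * indicator {0<..<r} \<tau> \<partial>lborel) =
        indicator {0<..<real (Suc (Suc k)) * s} r *
        ennreal (r ^ k * \<bar>?g (u + r)\<bar>) * emeasure lborel {0<..<r}"
        by (rule nn_integral_cmult_indicator) simp
      also have "\<dots> = indicator {0<..<real (Suc (Suc k)) * s} r *
        ennreal (r ^ Suc k * \<bar>?g (u + r)\<bar>)"
        by (auto simp: indicator_def ennreal_mult[symmetric] mult_ac)
      finally show "(\<integral>\<^sup>+\<tau>. indicator {0<..<real (Suc (Suc k)) * s} r *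
        ennreal (r ^ k * \<bar>?g (u + r)\<bar>) * indicator {0<..<r} \<tau> \<partial>lborel) =
        indicator {0<..<real (Suc (Suc k)) * s} r * ennreal (r ^ Suc k * \<bar>?g (u + r)\<bar>)" .
    qed
    finally show ?case .
  }
qed

section \<open>Iterated partial derivatives and the gradient norm\<close>

definition all_partials_differentiable :: "(real^'n \<Rightarrow> real) \<Rightarrow> bool" where
  "all_partials_differentiable f \<longleftrightarrow> (\<forall>is x. partials is f differentiable (at x))"

lemma partials_append: "partials (xs @ ys) f = partials xs (partials ys f)"
  by (induction xs) auto

lemma all_partials_differentiable_partials:
  "all_partials_differentiable f \<Longrightarrow> all_partials_differentiable (partials is f)"
  by (simp add: all_partials_differentiable_def flip: partials_append)

lemma continuous_on_partials:
  "all_partials_differentiable f \<Longrightarrow> continuous_on S (partials is f)"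
  unfolding all_partials_differentiable_def
  by (meson continuous_at_imp_continuous_on differentiable_imp_continuous_within)

lemma has_derivative_line:
  fixes f :: "real^'n \<Rightarrow> real"
  assumes "f differentiable (at (x + t *\<^sub>R h))"
  shows "((\<lambda>t. f (x + t *\<^sub>R h)) has_real_derivative frechet_derivative f (at (x + t *\<^sub>R h)) h) (at t)"
proof -
  let ?D = "frechet_derivative f (at (x + t *\<^sub>R h))"
  have D: "(f has_derivative ?D) (at (x + t *\<^sub>R h))"
    using assms by (simp add: frechet_derivative_works)
  have "((\<lambda>t. f (x + t *\<^sub>R h)) has_derivative (\<lambda>u. ?D (u *\<^sub>R h))) (at t)"
    by (rule has_derivative_compose[of "\<lambda>t. x + t *\<^sub>R h" "\<lambda>u. u *\<^sub>R h" t UNIV f ?D, OF _ D]) (auto intro!: derivative_eq_intros)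
  moreover have "(\<lambda>u. ?D (u *\<^sub>R h)) = (*) (?D h)"
    using linear_frechet_derivative[OF assms] by (auto simp: linear_cmul mult.commute)
  ultimately show ?thesis by (simp add: has_field_derivative_def)
qed

lemma partial_eq_frechet:
  assumes "f differentiable (at x)"
  shows "partial i f x = frechet_derivative f (at x) (axis i 1)"
  using has_derivative_line[of f x 0 "axis i 1"] assms
  by (simp add: partial_def DERIV_imp_deriv)

lemma has_derivative_line_partial:
  fixes f :: "real^'n \<Rightarrow> real"
  assumes "\<And>y. f differentiable (at y)"
  shows "((\<lambda>t. f (x + t *\<^sub>R h)) has_real_derivative (\<Sum>i\<in>UNIV. h $ i * partial i f (x + t *\<^sub>R h))) (at t)"
proof -
  let ?D = "frechet_derivative f (at (x + t *\<^sub>R h))"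
  have lin: "linear ?D" by (rule linear_frechet_derivative[OF assms])
  have "?D h = ?D (\<Sum>i\<in>UNIV. (h $ i) *\<^sub>R axis i 1)"
    using basis_expansion[of h] by (simp add: scalar_mult_eq_scaleR)
  also have "\<dots> = (\<Sum>i\<in>UNIV. h $ i * ?D (axis i 1))"
    by (simp add: linear_sum[OF lin] linear_cmul[OF lin])
  finally have "?D h = (\<Sum>i\<in>UNIV. h $ i * partial i f (x + t *\<^sub>R h))"
    by (simp add: partial_eq_frechet[OF assms])
  then show ?thesis
    using has_derivative_line[of f x t h] assms by simp
qed

lemma has_derivative_axis:
  fixes f :: "real^'n \<Rightarrow> real"
  assumes "\<And>y. f differentiable (at y)"
  shows "((\<lambda>t. f (x + t *\<^sub>R axis i 1)) has_real_derivative partial i f (x + t *\<^sub>R axis i 1)) (at t)"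
  using has_derivative_line[OF assms] by (simp add: partial_eq_frechet[OF assms])

text \<open>Two applications of the mean value theorem. The left-hand side is symmetric in \<open>i\<close> and \<open>j\<close>, so applying this in
both orders compares the two mixed derivatives at points near \<open>x\<close>.\<close>

lemma second_difference_mvt:
  fixes f :: "real^'n \<Rightarrow> real"
  assumes f: "\<And>y. f differentiable (at y)" and fi: "\<And>y. partial i f differentiable (at y)" and h: "h > 0"
  obtains \<sigma> \<tau> where "0 < \<sigma>" "\<sigma> < h" "0 < \<tau>" "\<tau> < h"
    "f (x + h *\<^sub>R axis i 1 + h *\<^sub>R axis j 1) - f (x + h *\<^sub>R axis i 1) - f (x + h *\<^sub>R axis j 1) + f x
      = h * h * partial j (partial i f) (x + \<sigma> *\<^sub>R axis i 1 + \<tau> *\<^sub>R axis j 1)"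
proof -
  let ?ei = "axis i 1 :: real^'n" and ?ej = "axis j 1 :: real^'n"
  define F where "F s = f ((x + h *\<^sub>R ?ej) + s *\<^sub>R ?ei) - f (x + s *\<^sub>R ?ei)" for s
  have "(F has_real_derivative (partial i f ((x + h *\<^sub>R ?ej) + s *\<^sub>R ?ei) - partial i f (x + s *\<^sub>R ?ei))) (at s)" for s
    unfolding F_def by (intro DERIV_diff has_derivative_axis f)
  then obtain \<sigma> where \<sigma>: "0 < \<sigma>" "\<sigma> < h"
    "F h - F 0 = (h - 0) * (partial i f ((x + h *\<^sub>R ?ej) + \<sigma> *\<^sub>R ?ei) - partial i f (x + \<sigma> *\<^sub>R ?ei))"
    using MVT2[OF h, of F "\<lambda>s. partial i f ((x + h *\<^sub>R ?ej) + s *\<^sub>R ?ei) - partial i f (x + s *\<^sub>R ?ei)"] by metis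
  have "((\<lambda>t. partial i f ((x + \<sigma> *\<^sub>R ?ei) + t *\<^sub>R ?ej)) has_real_derivative
      partial j (partial i f) ((x + \<sigma> *\<^sub>R ?ei) + t *\<^sub>R ?ej)) (at t)" for t
    by (intro has_derivative_axis fi)
  then obtain \<tau> where \<tau>: "0 < \<tau>" "\<tau> < h"
    "partial i f ((x + \<sigma> *\<^sub>R ?ei) + h *\<^sub>R ?ej) - partial i f ((x + \<sigma> *\<^sub>R ?ei) + 0 *\<^sub>R ?ej)
      = (h - 0) * partial j (partial i f) ((x + \<sigma> *\<^sub>R ?ei) + \<tau> *\<^sub>R ?ej)"
    using MVT2[OF h, of "\<lambda>t. partial i f ((x + \<sigma> *\<^sub>R ?ei) + t *\<^sub>R ?ej)"
      "\<lambda>t. partial j (partial i f) ((x + \<sigma> *\<^sub>R ?ei) + t *\<^sub>R ?ej)"] by metis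
  have "f (x + h *\<^sub>R ?ei + h *\<^sub>R ?ej) - f (x + h *\<^sub>R ?ei) - f (x + h *\<^sub>R ?ej) + f x = F h - F 0"
    by (simp add: F_def algebra_simps)
  also have "\<dots> = h * h * partial j (partial i f) (x + \<sigma> *\<^sub>R ?ei + \<tau> *\<^sub>R ?ej)"
    using \<sigma>(3) \<tau>(3) by (simp add: algebra_simps)
  finally show ?thesis using that \<sigma> \<tau> by blast
qed

lemma partial_commute:
  fixes f :: "real^'n \<Rightarrow> real"
  assumes "all_partials_differentiable f"
  shows "partial i (partial j f) = partial j (partial i f)"
proof
  fix x
  have f: "f differentiable (at y)" "partial k f differentiable (at y)" for y k
    using assms unfolding all_partials_differentiable_def
    by (metis partials.simps)+
  have c: "continuous (at x) (partial k (partial l f))" for k l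
    using assms unfolding all_partials_differentiable_def
    by (metis partials.simps differentiable_imp_continuous_within)
  show "partial i (partial j f) x = partial j (partial i f) x"
  proof (rule ccontr)
    assume ne: "partial i (partial j f) x \<noteq> partial j (partial i f) x"
    define e where "e = \<bar>partial i (partial j f) x - partial j (partial i f) x\<bar> / 2"
    have e: "e > 0" using ne by (simp add: e_def)
    obtain d1 where d1: "d1 > 0" "\<And>y. dist y x < d1 \<Longrightarrow> dist (partial i (partial j f) y) (partial i (partial j f) x) < e"
      using c[of i j] e unfolding continuous_at_eps_delta by blast
    obtain d2 where d2: "d2 > 0" "\<And>y. dist y x < d2 \<Longrightarrow> dist (partial j (partial i f) y) (partial j (partial i f) x) < e"
      using c[of j i] e unfolding continuous_at_eps_delta by blast
    define h where "h = min d1 d2 / 2"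
    have h: "h > 0" using d1 d2 by (simp add: h_def)
    have near: "dist (x + \<sigma> *\<^sub>R axis k 1 + \<tau> *\<^sub>R axis l 1) x < min d1 d2"
      if "0 < \<sigma>" "\<sigma> < h" "0 < \<tau>" "\<tau> < h" for \<sigma> \<tau> k l
    proof -
      have "dist (x + \<sigma> *\<^sub>R axis k 1 + \<tau> *\<^sub>R axis l 1) x = norm (\<sigma> *\<^sub>R (axis k 1 :: real^'n) + \<tau> *\<^sub>R axis l 1)"
        by (simp add: dist_norm algebra_simps)
      also have "\<dots> \<le> norm (\<sigma> *\<^sub>R (axis k 1 :: real^'n)) + norm (\<tau> *\<^sub>R (axis l 1 :: real^'n))"
        by (rule norm_triangle_ineq)
      also have "\<dots> = \<sigma> + \<tau>" using that by (simp add: norm_axis_1)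
      also have "\<dots> < min d1 d2" using that by (simp add: h_def)
      finally show ?thesis .
    qed
    obtain \<sigma> \<tau> where 1: "0 < \<sigma>" "\<sigma> < h" "0 < \<tau>" "\<tau> < h"
     "f (x + h *\<^sub>R axis i 1 + h *\<^sub>R axis j 1) - f (x + h *\<^sub>R axis i 1) - f (x + h *\<^sub>R axis j 1) + f x
      = h * h * partial j (partial i f) (x + \<sigma> *\<^sub>R axis i 1 + \<tau> *\<^sub>R axis j 1)"
      using second_difference_mvt[OF f h] by blast
    obtain \<sigma>' \<tau>' where 2: "0 < \<sigma>'" "\<sigma>' < h" "0 < \<tau>'" "\<tau>' < h"
     "f (x + h *\<^sub>R axis j 1 + h *\<^sub>R axis i 1) - f (x + h *\<^sub>R axis j 1) - f (x + h *\<^sub>R axis i 1) + f x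
      = h * h * partial i (partial j f) (x + \<sigma>' *\<^sub>R axis j 1 + \<tau>' *\<^sub>R axis i 1)"
      using second_difference_mvt[OF f h] by blast
    have "h * h * partial j (partial i f) (x + \<sigma> *\<^sub>R axis i 1 + \<tau> *\<^sub>R axis j 1)
        = h * h * partial i (partial j f) (x + \<sigma>' *\<^sub>R axis j 1 + \<tau>' *\<^sub>R axis i 1)"
      using 1(5) 2(5) by (simp add: algebra_simps)
    then have "partial j (partial i f) (x + \<sigma> *\<^sub>R axis i 1 + \<tau> *\<^sub>R axis j 1)
        = partial i (partial j f) (x + \<sigma>' *\<^sub>R axis j 1 + \<tau>' *\<^sub>R axis i 1)"
      using h by simp
    moreover have "dist (partial j (partial i f) (x + \<sigma> *\<^sub>R axis i 1 + \<tau> *\<^sub>R axis j 1)) (partial j (partial i f) x) < e"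
      using d2(2) near[OF 1(1-4), of i j] by simp
    moreover have "dist (partial i (partial j f) (x + \<sigma>' *\<^sub>R axis j 1 + \<tau>' *\<^sub>R axis i 1)) (partial i (partial j f) x) < e"
      using d1(2) near[OF 2(1-4), of j i] by simp
    ultimately show False unfolding e_def dist_real_def by (smt (verit) field_sum_of_halves)
  qed
qed

lemma partials_move_front:
  assumes "all_partials_differentiable f"
  shows "partials (xs @ i # ys) f = partials (i # xs @ ys) f"
proof (induction xs)
  case (Cons j xs)
  then show ?case
    using partial_commute[OF all_partials_differentiable_partials[OF assms, of "xs @ ys"], of i j] by simp
qed simp

lemma partials_cong_mset:
  assumes "all_partials_differentiable f"
  shows "mset xs = mset ys \<Longrightarrow> partials xs f = partials ys f"
proof (induction xs arbitrary: ys)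
  case (Cons i xs)
  then have "i \<in> set ys" by (metis list.set_intros(1) set_mset_mset)
  then obtain us vs where ys: "ys = us @ i # vs" by (meson split_list)
  with Cons.prems have "mset xs = mset (us @ vs)" by simp
  then have "partials (i # xs) f = partials (i # us @ vs) f" using Cons.IH[of "us @ vs"] by simp
  then show ?case using partials_move_front[OF assms] ys by simp
qed simp

text \<open>The gradient norm uses one list of directions for each multi-index; by symmetry of mixed
derivatives any other order gives the same derivative.\<close>

lemma abs_partials_le_gradient_norm:
  fixes f :: "real^'n \<Rightarrow> real"
  assumes "all_partials_differentiable f" and "length is = m"
  shows "\<bar>partials is f x\<bar> \<le> gradient_norm m f x"
proof -
  let ?\<alpha> = "\<lambda>i::'n. count_list is i"
  have \<alpha>: "?\<alpha> \<in> multi_indices m"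
    using assms(2) sum_count_set[of "is" UNIV] by (simp add: multi_indices_def)
  let ?js = "SOME js. \<forall>i. count_list js i = ?\<alpha> i"
  have "\<forall>i. count_list ?js i = ?\<alpha> i"
    using ex_list_multi_index[of ?\<alpha>] by (rule someI_ex)
  then have "mset ?js = mset is" by (intro multiset_eqI) (simp add: count_mset)
  then have "partials is f x = multi_partial ?\<alpha> f x"
    using partials_cong_mset[OF assms(1)] unfolding multi_partial_def by metis
  then have "\<bar>partials is f x\<bar> = sqrt ((multi_partial ?\<alpha> f x)\<^sup>2)" by simp
  also have "\<dots> \<le> gradient_norm m f x"
    unfolding gradient_norm_def real_sqrt_le_iff
    by (rule member_le_sum[OF \<alpha>, of "\<lambda>\<alpha>. (multi_partial \<alpha> f x)\<^sup>2"]) (auto simp: finite_multi_indices)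
  finally show ?thesis .
qed

lemma gradient_norm_nonneg: "0 \<le> gradient_norm m f x"
  by (simp add: gradient_norm_def sum_nonneg)

lemma borel_measurable_gradient_norm:
  assumes "all_partials_differentiable f"
  shows "gradient_norm m f \<in> borel_measurable borel"
  unfolding gradient_norm_def[abs_def] multi_partial_def
  by (intro borel_measurable_continuous_onI continuous_intros continuous_on_partials assms)

text \<open>The \<open>k\<close>-th derivative of \<open>t \<mapsto> f (x + t h)\<close>, written as a sum over ordered lists of directions: this
makes the step from \<open>k\<close> to \<open>k + 1\<close> a plain regrouping, without multinomial coefficients.\<close>

definition line_derivative :: "(real^'n \<Rightarrow> real) \<Rightarrow> real^'n \<Rightarrow> real^'n \<Rightarrow> nat \<Rightarrow> real \<Rightarrow> real" where
  "line_derivative f x h k t =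
     (\<Sum>is | length is = k. (\<Prod>i\<leftarrow>is. h $ i) * partials is f (x + t *\<^sub>R h))"

lemma line_derivative_has_derivative:
  fixes f :: "real^'n \<Rightarrow> real"
  assumes f: "all_partials_differentiable f"
  shows "(line_derivative f x h k has_real_derivative line_derivative f x h (Suc k) t) (at t)"
proof -
  have d: "partials is f differentiable (at y)" for "is" y
    using f by (simp add: all_partials_differentiable_def)
  let ?g = "\<lambda>is. (\<Prod>i\<leftarrow>is. h $ i) * partials is f (x + t *\<^sub>R h)"
  have "(line_derivative f x h k has_real_derivative
    (\<Sum>is | length is = k. (\<Prod>i\<leftarrow>is. h $ i) * (\<Sum>i\<in>UNIV. h $ i * partial i (partials is f) (x + t *\<^sub>R h)))) (at t)"
    unfolding line_derivative_def[abs_def]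
    by (intro DERIV_sum DERIV_cmult has_derivative_line_partial d)
  also have "(\<Sum>is | length is = k. (\<Prod>i\<leftarrow>is. h $ i) * (\<Sum>i\<in>UNIV. h $ i * partial i (partials is f) (x + t *\<^sub>R h)))
    = (\<Sum>is | length is = k. \<Sum>i\<in>UNIV. ?g (i # is))"
    by (simp add: sum_distrib_left mult_ac)
  also have "\<dots> = (\<Sum>(is, i)\<in>{is. length is = k} \<times> UNIV. ?g (i # is))"
    by (rule sum.cartesian_product)
  also have "\<dots> = (\<Sum>is | length is = Suc k. ?g is)"
    by (rule sum.reindex_bij_witness[of _ "\<lambda>js. (tl js, hd js)" "\<lambda>(is, i). i # is"])
       (auto simp: length_Suc_conv)
  finally show ?thesis unfolding line_derivative_def .
qed

lemma abs_line_derivative_le: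
  fixes f :: "real^'n \<Rightarrow> real"
  assumes f: "all_partials_differentiable f"
  shows "\<bar>line_derivative f x h k t\<bar> \<le> real CARD('n) ^ k * norm h ^ k * gradient_norm k f (x + t *\<^sub>R h)"
proof -
  have p: "\<bar>\<Prod>i\<leftarrow>is. h $ i\<bar> \<le> norm h ^ length is" for "is"
    by (induction "is") (auto simp: abs_mult intro!: mult_mono component_le_norm_cart)
  have "\<bar>line_derivative f x h k t\<bar> \<le>
     (\<Sum>is::'n list | length is = k. norm h ^ k * gradient_norm k f (x + t *\<^sub>R h))"
    unfolding line_derivative_def
  proof (intro order_trans[OF sum_abs] sum_mono)
    fix "is" :: "'n list" assume "is \<in> {is. length is = k}"
    then show "\<bar>(\<Prod>i\<leftarrow>is. h $ i) * partials is f (x + t *\<^sub>R h)\<bar> \<le> norm h ^ k * gradient_norm k f (x + t *\<^sub>R h)"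
      using p[of "is"] abs_partials_le_gradient_norm[OF f]
      by (auto simp: abs_mult intro!: mult_mono)
  qed
  also have "card {is::'n list. length is = k} = CARD('n) ^ k"
    using card_lists_length_eq[of "UNIV :: 'n set" k] by simp
  ultimately show ?thesis by (simp add: mult_ac)
qed

section \<open>A Sobolev representation on balls\<close>

lemma nn_integral_affine_euclidean:
  fixes f :: "'a::euclidean_space \<Rightarrow> ennreal"
  assumes [measurable]: "f \<in> borel_measurable borel" and c: "c > 0"
  shows "(\<integral>\<^sup>+x. f (t + c *\<^sub>R x) \<partial>lborel) = ennreal (1 / c ^ DIM('a)) * (\<integral>\<^sup>+x. f x \<partial>lborel)"
proof -
  have "c \<noteq> 0" using c by simp
  then have "(\<integral>\<^sup>+x. f x \<partial>lborel) = ennreal (c ^ DIM('a)) * (\<integral>\<^sup>+x. f (t + c *\<^sub>R x) \<partial>lborel)"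
    by (subst lborel_affine[of c t])
       (use c in \<open>simp_all add: nn_integral_density nn_integral_distr nn_integral_cmult\<close>)
  then show ?thesis
    using c by (simp add: mult.assoc[symmetric] ennreal_mult[symmetric])
qed

lemma nn_integral_powr_octave_le:
  fixes d \<alpha> :: real
  assumes d: "d > 0" and \<alpha>: "\<alpha> \<le> 0"
  shows "(\<integral>\<^sup>+t. indicator {d / 2<..<d} t * ennreal (t powr (\<alpha> - 1)) \<partial>lborel)
    \<le> ennreal (2 powr (- \<alpha>) * d powr \<alpha>)"
proof -
  have "(\<integral>\<^sup>+t. indicator {d / 2<..<d} t * ennreal (t powr (\<alpha> - 1)) \<partial>lborel) \<le>
    (\<integral>\<^sup>+t. ennreal ((d / 2) powr (\<alpha> - 1)) * indicator {d / 2<..<d} t \<partial>lborel)"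
    using d \<alpha> by (intro nn_integral_mono) (auto simp: indicator_def intro!: ennreal_leI powr_mono2')
  also have "\<dots> = ennreal ((d / 2) powr (\<alpha> - 1)) * ennreal (d / 2)"
    using d by (simp add: nn_integral_cmult_indicator)
  also have "\<dots> = ennreal ((d / 2) powr (\<alpha> - 1) * (d / 2))"
    by (rule ennreal_mult'[symmetric]) (use d in simp)
  also have "(d / 2) powr (\<alpha> - 1) * (d / 2) = (d / 2) powr \<alpha>"
    using d by (simp add: powr_diff)
  also have "\<dots> = 2 powr (- \<alpha>) * d powr \<alpha>"
    using d by (simp add: powr_divide powr_minus field_simps)
  finally show ?thesis .
qed

text \<open>Along the segment in direction \<open>h\<close>, the value at \<open>x\<close> differs from a combination of values at \<open>m\<close> other
points by an \<open>m\<close>-th difference, and that difference sees only derivatives of order exactly \<open>m\<close>.\<close>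

lemma sobolev_line_representation:
  fixes f :: "real^'n \<Rightarrow> real"
  assumes f: "all_partials_differentiable f" and m: "m > 0" and s: "s > 0" and h: "norm h \<le> 2"
  shows "ennreal \<bar>f x\<bar> \<le> ennreal (2 ^ m) * (\<Sum>j\<in>{1..m}. ennreal \<bar>f (x + (real j * s) *\<^sub>R h)\<bar>) +
      ennreal ((2 * CARD('n)) ^ m) *
      (\<integral>\<^sup>+t. indicator {0<..<real m * s} t * ennreal (t ^ (m - 1) * gradient_norm m f (x + t *\<^sub>R h)) \<partial>lborel)"
    (is "_ \<le> ?S + ennreal ?c * ?I")
proof -
  note [measurable] = borel_measurable_gradient_norm[OF f]
  obtain k where k: "m = Suc k" using m by (cases m) auto
  let ?G = "line_derivative f x h"
  have G0: "?G 0 t = f (x + t *\<^sub>R h)" for t by (simp add: line_derivative_def)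
  have "ennreal \<bar>fdiff m s (?G 0) 0\<bar> \<le>
    (\<integral>\<^sup>+t. indicator {0<..<real m * s} t * ennreal (t ^ (m - 1) * \<bar>?G m t\<bar>) \<partial>lborel)"
    using fdiff_le_nn_integral[of ?G s k 0 0, OF line_derivative_has_derivative[OF f]] s k by simp
  also have "\<dots> \<le> (\<integral>\<^sup>+t. ennreal ?c * (indicator {0<..<real m * s} t *
        ennreal (t ^ (m - 1) * gradient_norm m f (x + t *\<^sub>R h))) \<partial>lborel)"
  proof (intro nn_integral_mono)
    fix t :: real
    let ?H = "gradient_norm m f (x + t *\<^sub>R h)"
    have "\<bar>?G m t\<bar> \<le> real CARD('n) ^ m * norm h ^ m * ?H"
      by (rule abs_line_derivative_le[OF f])
    also have "\<dots> \<le> real CARD('n) ^ m * 2 ^ m * ?H"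
      using h by (intro mult_right_mono mult_left_mono power_mono) (auto simp: gradient_norm_nonneg)
    finally have G: "\<bar>?G m t\<bar> \<le> ?c * ?H" by (simp add: power_mult_distrib mult_ac)
    have "ennreal (t ^ (m - 1) * \<bar>?G m t\<bar>) \<le> ennreal ?c * ennreal (t ^ (m - 1) * ?H)" if "t > 0"
    proof -
      have "t ^ (m - 1) * \<bar>?G m t\<bar> \<le> ?c * (t ^ (m - 1) * ?H)"
        using mult_left_mono[OF G, of "t ^ (m - 1)"] that by (simp add: mult_ac)
      then show ?thesis by (subst ennreal_mult'[symmetric]) (auto intro: ennreal_leI)
    qed
    then show "indicator {0<..<real m * s} t * ennreal (t ^ (m - 1) * \<bar>?G m t\<bar>)
      \<le> ennreal ?c * (indicator {0<..<real m * s} t * ennreal (t ^ (m - 1) * ?H))"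
      by (auto simp: indicator_def)
  qed
  also have "\<dots> = ennreal ?c * ?I" by (rule nn_integral_cmult) measurable
  finally have 1: "ennreal \<bar>fdiff m s (?G 0) 0\<bar> \<le> ennreal ?c * ?I" .
  have "\<bar>f x\<bar> \<le> \<bar>fdiff m s (?G 0) 0\<bar> + 2 ^ m * (\<Sum>j\<in>{1..m}. \<bar>f (x + (real j * s) *\<^sub>R h)\<bar>)"
    using abs_le_fdiff[of "?G 0" 0 m s] by (simp add: G0)
  then have "ennreal \<bar>f x\<bar> \<le> ennreal (\<bar>fdiff m s (?G 0) 0\<bar> + 2 ^ m * (\<Sum>j\<in>{1..m}. \<bar>f (x + (real j * s) *\<^sub>R h)\<bar>))"
    by (rule ennreal_leI)
  also have "\<dots> = ennreal \<bar>fdiff m s (?G 0) 0\<bar> + ?S"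
    by (simp add: ennreal_plus sum_nonneg ennreal_mult sum_ennreal del: ennreal_numeral)
  also have "\<dots> \<le> ennreal ?c * ?I + ?S" using 1 by (rule add_right_mono)
  finally show ?thesis by (simp add: add.commute)
qed

text \<open>Averaging over directions in an annulus rather than over the sphere allows a linear change of
variables to take the place of polar coordinates.\<close>

lemma nn_integral_annulus_dilate:
  fixes f :: "real^'n \<Rightarrow> ennreal"
  assumes [measurable]: "f \<in> borel_measurable borel" and c: "c > 0"
  shows "(\<integral>\<^sup>+h. indicator {h. 1 < norm h \<and> norm h < 2} h * f (x + c *\<^sub>R h) \<partial>lborel)
    = ennreal (1 / c ^ CARD('n)) * (\<integral>\<^sup>+y. indicator {y. c < norm (x - y) \<and> norm (x - y) < 2 * c} y * f y \<partial>lborel)"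
proof -
  have "indicator {h. 1 < norm h \<and> norm h < 2} h =
      (indicator {y. c < norm (x - y) \<and> norm (x - y) < 2 * c} (x + c *\<^sub>R h) :: ennreal)" for h
    using c by (auto simp: indicator_def)
  then have "(\<integral>\<^sup>+h. indicator {h. 1 < norm h \<and> norm h < 2} h * f (x + c *\<^sub>R h) \<partial>lborel) =
    (\<integral>\<^sup>+h. (\<lambda>y. indicator {y. c < norm (x - y) \<and> norm (x - y) < 2 * c} y * f y) (x + c *\<^sub>R h) \<partial>lborel)"
    by simp
  also have "\<dots> = ennreal (1 / c ^ DIM(real^'n)) * (\<integral>\<^sup>+y. indicator {y. c < norm (x - y) \<and> norm (x - y) < 2 * c} y * f y \<partial>lborel)"
    by (rule nn_integral_affine_euclidean[OF _ c]) measurable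
  finally show ?thesis by simp
qed

text \<open>For fixed \<open>t\<close> the substitution \<open>y = x + t h\<close> has Jacobian \<open>t\<^sup>-\<^sup>n\<close> and restricts \<open>t\<close> to \<open>(|x-y|/2, |x-y|)\<close>.
Integrating \<open>t\<close> to the power \<open>m - 1 - n\<close> over this interval gives a multiple of the Riesz kernel.\<close>

lemma riesz_kernel_from_annuli:
  fixes H :: "real^'n \<Rightarrow> real"
  assumes [measurable]: "H \<in> borel_measurable borel" and H: "\<And>y. 0 \<le> H y"
    and m: "m > 0" "m < CARD('n)" and R: "R > 0"
  shows "(\<integral>\<^sup>+h. indicator {h. 1 < norm h \<and> norm h < 2} h *
      (\<integral>\<^sup>+t. indicator {0<..<R} t * ennreal (t ^ (m - 1) * H (x + t *\<^sub>R h)) \<partial>lborel) \<partial>lborel)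
    \<le> ennreal (2 ^ CARD('n)) *
      (\<integral>\<^sup>+y. indicator (ball x (2 * R)) y * ennreal (H y * norm (x - y) powr (real m - real CARD('n))) \<partial>lborel)"
proof -
  let ?n = "CARD('n)"
  have [measurable]: "(\<lambda>y. norm (x - y) powr (real m - real ?n)) \<in> borel_measurable borel"
    by (intro powr_real_measurable borel_measurable_norm borel_measurable_diff measurable_const measurable_ident_sets) simp_all
  have [measurable]: "ball x (2 * R) \<in> sets borel" by simp
  let ?A = "{h::real^'n. 1 < norm h \<and> norm h < 2}"
  let ?B = "\<lambda>t. {y. t < norm (x - y) \<and> norm (x - y) < 2 * t}"
  have "(\<integral>\<^sup>+h. indicator ?A h *
      (\<integral>\<^sup>+t. indicator {0<..<R} t * ennreal (t ^ (m - 1) * H (x + t *\<^sub>R h)) \<partial>lborel) \<partial>lborel)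
    = (\<integral>\<^sup>+h. (\<integral>\<^sup>+t. indicator ?A h *
        (indicator {0<..<R} t * ennreal (t ^ (m - 1) * H (x + t *\<^sub>R h))) \<partial>lborel) \<partial>lborel)"
    by (intro nn_integral_cong nn_integral_cmult[symmetric]) measurable
  also have "\<dots> = (\<integral>\<^sup>+t. (\<integral>\<^sup>+h. indicator ?A h *
        (indicator {0<..<R} t * ennreal (t ^ (m - 1) * H (x + t *\<^sub>R h))) \<partial>lborel) \<partial>lborel)"
    by (rule lborel_pair.Fubini'[symmetric]) measurable
  also have "\<dots> = (\<integral>\<^sup>+t. (\<integral>\<^sup>+y. indicator {0<..<R} t * ennreal (t powr (real m - real ?n - 1)) *
        (indicator (?B t) y * ennreal (H y)) \<partial>lborel) \<partial>lborel)"
  proof (rule nn_integral_cong)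
    fix t :: real
    show "(\<integral>\<^sup>+h. indicator ?A h * (indicator {0<..<R} t * ennreal (t ^ (m - 1) * H (x + t *\<^sub>R h))) \<partial>lborel)
      = (\<integral>\<^sup>+y. indicator {0<..<R} t * ennreal (t powr (real m - real ?n - 1)) *
        (indicator (?B t) y * ennreal (H y)) \<partial>lborel)"
    proof (cases "0 < t \<and> t < R")
      case True
      then have t: "0 < t" by simp
      have "(\<integral>\<^sup>+h. indicator ?A h * (indicator {0<..<R} t * ennreal (t ^ (m - 1) * H (x + t *\<^sub>R h))) \<partial>lborel)
        = (\<integral>\<^sup>+h. ennreal (t ^ (m - 1)) * (indicator ?A h * ennreal (H (x + t *\<^sub>R h))) \<partial>lborel)"
        using True by (intro nn_integral_cong) (simp add: ennreal_mult' mult_ac H)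
      also have "\<dots> = ennreal (t ^ (m - 1)) * (\<integral>\<^sup>+h. indicator ?A h * ennreal (H (x + t *\<^sub>R h)) \<partial>lborel)"
        by (rule nn_integral_cmult) measurable
      also have "\<dots> = ennreal (t ^ (m - 1)) * (ennreal (1 / t ^ ?n) * (\<integral>\<^sup>+y. indicator (?B t) y * ennreal (H y) \<partial>lborel))"
        by (subst nn_integral_annulus_dilate[OF _ t, of "\<lambda>y. ennreal (H y)"]) simp_all
      also have "\<dots> = ennreal (t ^ (m - 1) * (1 / t ^ ?n)) * (\<integral>\<^sup>+y. indicator (?B t) y * ennreal (H y) \<partial>lborel)"
        using t by (subst ennreal_mult) (auto simp: mult.assoc)
      also have "t ^ (m - 1) * (1 / t ^ ?n) = t powr (real m - real ?n - 1)"
        using t m by (simp add: powr_diff powr_add powr_realpow power_diff field_simps)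
      also have "ennreal (t powr (real m - real ?n - 1)) * (\<integral>\<^sup>+y. indicator (?B t) y * ennreal (H y) \<partial>lborel)
        = (\<integral>\<^sup>+y. ennreal (t powr (real m - real ?n - 1)) * (indicator (?B t) y * ennreal (H y)) \<partial>lborel)"
        by (rule nn_integral_cmult[symmetric]) measurable
      finally show ?thesis using True by simp
    qed (auto simp: indicator_def)
  qed
  also have "\<dots> = (\<integral>\<^sup>+y. (\<integral>\<^sup>+t. indicator {0<..<R} t * ennreal (t powr (real m - real ?n - 1)) *
        (indicator (?B t) y * ennreal (H y)) \<partial>lborel) \<partial>lborel)"
    unfolding indicator_def by (rule lborel_pair.Fubini'[symmetric]) measurable
  also have "\<dots> \<le> (\<integral>\<^sup>+y. ennreal (2 ^ ?n) *
      (indicator (ball x (2 * R)) y * ennreal (H y * norm (x - y) powr (real m - real ?n))) \<partial>lborel)"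
  proof (intro nn_integral_mono)
    fix y
    let ?d = "norm (x - y)"
    let ?\<alpha> = "real m - real ?n"
    show "(\<integral>\<^sup>+t. indicator {0<..<R} t * ennreal (t powr (?\<alpha> - 1)) * (indicator (?B t) y * ennreal (H y)) \<partial>lborel)
      \<le> ennreal (2 ^ ?n) * (indicator (ball x (2 * R)) y * ennreal (H y * ?d powr ?\<alpha>))"
    proof (cases "0 < ?d \<and> ?d < 2 * R")
      case True
      then have d: "0 < ?d" by simp
      have "(\<integral>\<^sup>+t. indicator {0<..<R} t * ennreal (t powr (?\<alpha> - 1)) * (indicator (?B t) y * ennreal (H y)) \<partial>lborel)
        \<le> (\<integral>\<^sup>+t. ennreal (H y) * (indicator {?d / 2<..<?d} t * ennreal (t powr (?\<alpha> - 1))) \<partial>lborel)"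
        by (intro nn_integral_mono) (auto simp: indicator_def mult.commute)
      also have "\<dots> = ennreal (H y) * (\<integral>\<^sup>+t. indicator {?d / 2<..<?d} t * ennreal (t powr (?\<alpha> - 1)) \<partial>lborel)"
        by (rule nn_integral_cmult) measurable
      also have "\<dots> \<le> ennreal (H y) * ennreal (2 powr (- ?\<alpha>) * ?d powr ?\<alpha>)"
        using m by (intro mult_left_mono nn_integral_powr_octave_le d) auto
      also have "\<dots> = ennreal (H y * (2 powr (- ?\<alpha>) * ?d powr ?\<alpha>))"
        by (rule ennreal_mult'[symmetric]) (rule H)
      also have "\<dots> \<le> ennreal (2 ^ ?n * (H y * ?d powr ?\<alpha>))"
      proof (rule ennreal_leI)
        have "(2::real) powr (- ?\<alpha>) \<le> 2 powr real ?n" by (rule powr_mono) auto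
        then have "2 powr (- ?\<alpha>) * (H y * ?d powr ?\<alpha>) \<le> 2 ^ ?n * (H y * ?d powr ?\<alpha>)"
          by (intro mult_right_mono) (auto simp: powr_realpow H)
        then show "H y * (2 powr (- ?\<alpha>) * ?d powr ?\<alpha>) \<le> 2 ^ ?n * (H y * ?d powr ?\<alpha>)"
          by (simp add: mult_ac)
      qed
      also have "\<dots> = ennreal (2 ^ ?n) * ennreal (H y * ?d powr ?\<alpha>)"
        by (rule ennreal_mult') simp
      finally show ?thesis using True by (simp add: dist_norm)
    next
      case False
      then have z: "indicator {0<..<R} t * ennreal (t powr (?\<alpha> - 1)) * (indicator (?B t) y * ennreal (H y)) = 0" for t
        by (auto simp: indicator_def)
      show ?thesis unfolding z by simp
    qed
  qed
  also have "\<dots> = ennreal (2 ^ ?n) *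
      (\<integral>\<^sup>+y. indicator (ball x (2 * R)) y * ennreal (H y * norm (x - y) powr (real m - real ?n)) \<partial>lborel)"
    by (rule nn_integral_cmult) measurable
  finally show ?thesis .
qed

text \<open>Average the representation along segments over \<open>1 < |h| < 2\<close>. The sample points \<open>x + j r h\<close> with \<open>1 \<le> j \<le> m\<close>
spread over annuli of volume at least a multiple of \<open>r\<^sup>n\<close>, which turns the point values into a mean
over a ball; the remainder becomes a truncated Riesz potential.\<close>

lemma local_sobolev_representation:
  assumes m: "m > 0" "m < CARD('n)"
  obtains C :: real where "C > 0"
    "\<And>(f :: real^'n \<Rightarrow> real) r x. all_partials_differentiable f \<Longrightarrow> r > 0 \<Longrightarrow>
      ennreal \<bar>f x\<bar> \<le>
        ennreal (C / r ^ CARD('n)) * (\<integral>\<^sup>+y. indicator (ball x (2 * real m * r)) y * ennreal \<bar>f y\<bar> \<partial>lborel)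
        + ennreal C * (\<integral>\<^sup>+y. indicator (ball x (2 * real m * r)) y *
            ennreal (gradient_norm m f y * norm (x - y) powr (real m - real CARD('n))) \<partial>lborel)"
proof -
  let ?n = "CARD('n)"
  let ?A = "{h::real^'n. 1 < norm h \<and> norm h < 2}"
  define a where "a = measure lborel ?A"
  have A_ball: "?A \<subseteq> ball 0 2" by (auto simp: dist_norm)
  have A_fin: "emeasure lborel ?A \<noteq> \<infinity>"
    using emeasure_mono[OF A_ball, of lborel] emeasure_lborel_ball_finite[of "0::real^'n" 2]
    by (auto simp: top_unique)
  have A_eq: "emeasure lborel ?A = ennreal a"
    unfolding a_def by (rule emeasure_eq_ennreal_measure) (use A_fin in auto)
  \<comment> \<open>The annulus has positive measure because it contains a ball.\<close>
  have "ball ((3/2) *\<^sub>R axis undefined 1) (1/2) \<subseteq> ?A"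
  proof
    fix h :: "real^'n" assume h: "h \<in> ball ((3/2) *\<^sub>R axis undefined 1) (1/2)"
    let ?c = "(3/2) *\<^sub>R axis undefined 1 :: real^'n"
    have "norm ?c = 3/2" by (simp add: norm_axis_1)
    moreover have "norm (?c - h) < 1/2" using h by (simp add: dist_norm)
    ultimately show "h \<in> ?A"
      using norm_triangle_ineq2[of ?c h] norm_triangle_ineq3[of ?c h] by auto
  qed
  then have "emeasure lborel (ball ((3/2) *\<^sub>R axis undefined 1 :: real^'n) (1/2)) \<le> emeasure lborel ?A"
    by (rule emeasure_mono) measurable
  moreover have "emeasure lborel (ball ((3/2) *\<^sub>R axis undefined 1 :: real^'n) (1/2)) > 0"
    by (simp add: emeasure_ball)
  ultimately have a: "a > 0" unfolding A_eq by (metis ennreal_less_zero_iff less_le_trans)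
  let ?c = "real ((2 * ?n) ^ m)"
  define C where "C = (2 ^ m * real m + ?c * 2 ^ ?n) / a"
  have C: "C > 0" unfolding C_def using a m by (intro divide_pos_pos add_pos_nonneg) auto
  show ?thesis
  proof (rule that[OF C])
    fix f :: "real^'n \<Rightarrow> real" and r :: real and x :: "real^'n"
    assume f: "all_partials_differentiable f" and r: "r > 0"
    note [measurable] = borel_measurable_gradient_norm[OF f]
    have [measurable]: "f \<in> borel_measurable borel"
      using continuous_on_partials[OF f, of UNIV "[]"] by (auto intro: borel_measurable_continuous_onI)
    let ?B = "ball x (2 * real m * r)"
    let ?F = "\<integral>\<^sup>+y. indicator ?B y * ennreal \<bar>f y\<bar> \<partial>lborel"
    let ?R = "\<integral>\<^sup>+y. indicator ?B y * ennreal (gradient_norm m f y * norm (x - y) powr (real m - real ?n)) \<partial>lborel"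
    let ?I = "\<lambda>h. \<integral>\<^sup>+t. indicator {0<..<real m * r} t * ennreal (t ^ (m - 1) * gradient_norm m f (x + t *\<^sub>R h)) \<partial>lborel"
    have lin: "(\<integral>\<^sup>+h. c * (\<Sum>j\<in>{1..m}. u j h) + d * v h \<partial>lborel)
        = c * (\<Sum>j\<in>{1..m}. \<integral>\<^sup>+h. u j h \<partial>lborel) + d * (\<integral>\<^sup>+h. v h \<partial>lborel)"
      if [measurable]: "\<And>j. u j \<in> borel_measurable borel" "v \<in> borel_measurable borel"
      for c d and u :: "nat \<Rightarrow> real^'n \<Rightarrow> ennreal" and v
      by (simp add: nn_integral_add nn_integral_cmult nn_integral_sum)
    have "ennreal a * ennreal \<bar>f x\<bar> = (\<integral>\<^sup>+h. ennreal \<bar>f x\<bar> * indicator ?A h \<partial>lborel)"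
      by (subst nn_integral_cmult_indicator) (auto simp: A_eq mult.commute)
    also have "\<dots> \<le> (\<integral>\<^sup>+h. ennreal (2 ^ m) * (\<Sum>j\<in>{1..m}. indicator ?A h * ennreal \<bar>f (x + (real j * r) *\<^sub>R h)\<bar>) +
        ennreal ?c * (indicator ?A h * ?I h) \<partial>lborel)"
    proof (intro nn_integral_mono)
      fix h :: "real^'n"
      show "ennreal \<bar>f x\<bar> * indicator ?A h \<le>
        ennreal (2 ^ m) * (\<Sum>j\<in>{1..m}. indicator ?A h * ennreal \<bar>f (x + (real j * r) *\<^sub>R h)\<bar>) +
        ennreal ?c * (indicator ?A h * ?I h)"
        using sobolev_line_representation[OF f m(1) r, of h x] by (auto simp: indicator_def)
    qed
    also have "\<dots> = ennreal (2 ^ m) * (\<Sum>j\<in>{1..m}. \<integral>\<^sup>+h. indicator ?A h * ennreal \<bar>f (x + (real j * r) *\<^sub>R h)\<bar> \<partial>lborel) +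
        ennreal ?c * (\<integral>\<^sup>+h. indicator ?A h * ?I h \<partial>lborel)"
      by (rule lin) measurable
    also have "\<dots> \<le> ennreal (2 ^ m) * (\<Sum>j\<in>{1..m}. ennreal (1 / r ^ ?n) * ?F) +
        ennreal ?c * (ennreal (2 ^ ?n) * ?R)"
    proof (intro add_mono mult_left_mono sum_mono zero_le)
      fix j assume j: "j \<in> {1..m}"
      then have jr: "real j * r > 0" "r \<le> real j * r" "real j * r \<le> real m * r" using r by auto
      have "(\<integral>\<^sup>+h. indicator ?A h * ennreal \<bar>f (x + (real j * r) *\<^sub>R h)\<bar> \<partial>lborel) =
        ennreal (1 / (real j * r) ^ ?n) * (\<integral>\<^sup>+y. indicator {y. real j * r < norm (x - y) \<and> norm (x - y) < 2 * (real j * r)} y * ennreal \<bar>f y\<bar> \<partial>lborel)"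
        by (subst nn_integral_annulus_dilate[OF _ jr(1), of "\<lambda>y. ennreal \<bar>f y\<bar>"]) simp_all
      also have "\<dots> \<le> ennreal (1 / r ^ ?n) * ?F"
      proof (rule mult_mono)
        show "ennreal (1 / (real j * r) ^ ?n) \<le> ennreal (1 / r ^ ?n)"
          using jr r by (intro ennreal_leI divide_left_mono power_mono mult_pos_pos zero_less_power) auto
        show "(\<integral>\<^sup>+y. indicator {y. real j * r < norm (x - y) \<and> norm (x - y) < 2 * (real j * r)} y * ennreal \<bar>f y\<bar> \<partial>lborel)
          \<le> ?F"
          using jr by (intro nn_integral_mono) (auto simp: indicator_def dist_norm)
      qed auto
      finally show "(\<integral>\<^sup>+h. indicator ?A h * ennreal \<bar>f (x + (real j * r) *\<^sub>R h)\<bar> \<partial>lborel) \<le> ennreal (1 / r ^ ?n) * ?F" .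
    next
      show "(\<integral>\<^sup>+h. indicator ?A h * ?I h \<partial>lborel) \<le> ennreal (2 ^ ?n) * ?R"
        using riesz_kernel_from_annuli[of "gradient_norm m f" m "real m * r" x] m r
        by (simp add: gradient_norm_nonneg mult.assoc)
    qed
    also have "\<dots> = ennreal (2 ^ m * real m / r ^ ?n) * ?F + ennreal (?c * 2 ^ ?n) * ?R"
    proof -
      have 1: "ennreal (2 ^ m) * (\<Sum>j\<in>{1..m}. ennreal (1 / r ^ ?n) * ?F) = ennreal (2 ^ m * real m / r ^ ?n) * ?F"
      proof -
        have "(\<Sum>j\<in>{1..m}. ennreal (1 / r ^ ?n) * ?F) = ennreal (real m) * (ennreal (1 / r ^ ?n) * ?F)"
          by (simp add: ennreal_of_nat_eq_real_of_nat)
        then show ?thesis using r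
          by (simp add: mult.assoc[symmetric] ennreal_mult[symmetric] del: ennreal_power)
      qed
      have 2: "ennreal ?c * (ennreal (2 ^ ?n) * ?R) = ennreal (?c * 2 ^ ?n) * ?R"
        by (subst ennreal_mult) (auto simp: mult.assoc)
      show ?thesis unfolding 1 2 ..
    qed
    also have "\<dots> \<le> ennreal (a * (C / r ^ ?n)) * ?F + ennreal (a * C) * ?R"
      using a r by (intro add_mono mult_right_mono ennreal_leI) (auto simp: C_def field_simps)
    also have "\<dots> = ennreal a * (ennreal (C / r ^ ?n) * ?F + ennreal C * ?R)"
    proof -
      have e: "ennreal (a * t) = ennreal a * ennreal t" for t using a by (simp add: ennreal_mult')
      show ?thesis unfolding e by (simp only: distrib_left mult.assoc)
    qed
    finally show "ennreal \<bar>f x\<bar> \<le> ennreal (C / r ^ ?n) * ?F + ennreal C * ?R"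
      using a by (subst (asm) ennreal_mult_le_mult_iff) auto
  qed
qed

section \<open>The power weight on balls\<close>

lemma le_suminf_ennreal: "g k \<le> suminf g" for g :: "nat \<Rightarrow> ennreal"
  using sum_le_suminf[of g "{k}"] by simp

lemma power_weight_le_dyadic:
  fixes x :: "real^'n"
  assumes a: "a \<le> 0" and R: "R > 0"
  shows "indicator (ball 0 R) x * ennreal (power_weight a x)
      \<le> (\<Sum>k. ennreal ((R / 2 ^ Suc k) powr a) * indicator (ball 0 (R / 2 ^ k)) x)" (is "?l \<le> suminf ?g")
proof (cases "0 < norm x \<and> norm x < R")
  case True
  then have x: "0 < norm x" "norm x < R" by auto
  obtain k where k: "R / 2 ^ Suc k \<le> norm x" "norm x < R / 2 ^ k"
  proof -
    have "\<exists>k. R / 2 ^ k \<le> norm x"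
    proof -
      obtain k where "R / norm x < 2 ^ k" using real_arch_pow[of 2 "R / norm x"] by auto
      then have "R / 2 ^ k \<le> norm x" using x by (simp add: field_simps)
      then show ?thesis ..
    qed
    then obtain k where k: "R / 2 ^ k \<le> norm x" "\<And>j. j < k \<Longrightarrow> \<not> R / 2 ^ j \<le> norm x"
      using exists_least_iff[of "\<lambda>k. R / 2 ^ k \<le> norm x"] by blast
    with x have "k \<noteq> 0" by (intro notI) auto
    then obtain j where "k = Suc j" by (cases k) auto
    with k(1) k(2)[of j] that[of j] show ?thesis by auto
  qed
  have "?l = ennreal (norm x powr a)" using x by (simp add: power_weight_def)
  also have "\<dots> \<le> ennreal ((R / 2 ^ Suc k) powr a)"
    using k(1) R a by (intro ennreal_leI powr_mono2') auto
  also have "\<dots> = ?g k" using k by simp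
  also have "?g k \<le> suminf ?g" by (rule le_suminf_ennreal)
  finally show ?thesis .
next
  case False
  then have "?l = 0" by (auto simp: indicator_def power_weight_def)
  then show ?thesis by (simp only: zero_le)
qed
text \<open>On the dyadic shell of radius \<open>2\<^sup>-\<^sup>k R\<close> the weight is comparable to a constant, and the shell contributes a multiple of
\<open>(2\<^sup>-\<^sup>k R) powr (n + a)\<close>; the series converges because \<open>n + a > 0\<close>.\<close>

lemma nn_integral_power_weight_centred_ball_le:
  assumes a: "- real CARD('n) < a" "a \<le> 0"
  obtains C :: real where "C > 0"
    "\<And>R. R > 0 \<Longrightarrow> (\<integral>\<^sup>+x. indicator (ball (0::real^'n) R) x * ennreal (power_weight a x) \<partial>lborel)
       \<le> ennreal (C * R powr (real CARD('n) + a))"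
proof -
  let ?n = "CARD('n)"
  let ?U = "unit_ball_vol (real ?n)"
  define \<theta> where "\<theta> = (1/2::real) powr (real ?n + a)"
  have \<theta>: "0 < \<theta>" "\<theta> < 1" using a powr01_less_one[of "1/2" "real ?n + a"] unfolding \<theta>_def by auto
  define C where "C = 2 powr (- a) * ?U / (1 - \<theta>)"
  have C: "C > 0" using \<theta> by (simp add: C_def)
  have scale: "(\<rho> / 2) powr a * (?U * \<rho> ^ ?n) = 2 powr (- a) * ?U * \<rho> powr (real ?n + a)" if "\<rho> > 0" for \<rho> :: real
  proof -
    have "(\<rho> / 2) powr a = \<rho> powr a * 2 powr (- a)"
      using that by (simp add: powr_divide powr_minus_divide)
    moreover have "\<rho> powr (real ?n + a) = \<rho> ^ ?n * \<rho> powr a"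
      using that by (simp add: powr_add powr_realpow)
    ultimately show ?thesis by (simp only: mult_ac)
  qed
  have piece: "(\<integral>\<^sup>+x. ennreal ((R / 2 ^ Suc k) powr a) * indicator (ball (0::real^'n) (R / 2 ^ k)) x \<partial>lborel)
      = ennreal (2 powr (- a) * ?U * R powr (real ?n + a) * \<theta> ^ k)" if R: "R > 0" for R k
  proof -
    define \<rho> where "\<rho> = R / 2 ^ k"
    have \<rho>: "\<rho> > 0" "R / 2 ^ Suc k = \<rho> / 2" using R by (simp_all add: \<rho>_def)
    have "\<rho> = R * (1/2) powr real k" by (simp add: \<rho>_def powr_realpow power_one_over)
    then have "\<rho> powr (real ?n + a) = R powr (real ?n + a) * ((1/2) powr real k) powr (real ?n + a)"
      using R by (simp add: powr_mult)
    also have "((1/2::real) powr real k) powr (real ?n + a) = \<theta> powr real k"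
      unfolding \<theta>_def powr_powr by (simp only: mult.commute)
    also have "\<dots> = \<theta> ^ k" using \<theta> by (simp add: powr_realpow)
    finally have 1: "\<rho> powr (real ?n + a) = R powr (real ?n + a) * \<theta> ^ k" .
    have "(\<integral>\<^sup>+x. ennreal ((\<rho> / 2) powr a) * indicator (ball (0::real^'n) \<rho>) x \<partial>lborel)
      = ennreal ((\<rho> / 2) powr a) * ennreal (?U * \<rho> ^ ?n)"
      using \<rho> by (subst nn_integral_cmult_indicator) (simp_all add: emeasure_ball)
    also have "\<dots> = ennreal ((\<rho> / 2) powr a * (?U * \<rho> ^ ?n))"
      by (rule ennreal_mult'[symmetric]) simp
    also have "(\<rho> / 2) powr a * (?U * \<rho> ^ ?n) = 2 powr (- a) * ?U * (R powr (real ?n + a) * \<theta> ^ k)"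
      by (simp only: scale[OF \<rho>(1)] 1)
    finally show ?thesis unfolding \<rho>(2) \<rho>_def[symmetric] by (simp only: mult.assoc)
  qed
  show ?thesis
  proof (rule that[OF C])
    fix R :: real assume R: "R > 0"
    let ?c = "2 powr (- a) * ?U * R powr (real ?n + a)"
    have "norm \<theta> < 1" using \<theta> by simp
    then have s: "(\<lambda>k. ?c * \<theta> ^ k) sums (?c * (1 / (1 - \<theta>)))"
      by (intro sums_mult[of "\<lambda>k. \<theta> ^ k"] geometric_sums)
    have "(\<integral>\<^sup>+x. indicator (ball (0::real^'n) R) x * ennreal (power_weight a x) \<partial>lborel)
       \<le> (\<integral>\<^sup>+x. (\<Sum>k. ennreal ((R / 2 ^ Suc k) powr a) * indicator (ball (0::real^'n) (R / 2 ^ k)) x) \<partial>lborel)"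
      by (intro nn_integral_mono power_weight_le_dyadic a(2) R)
    also have "\<dots> = (\<Sum>k. \<integral>\<^sup>+x. ennreal ((R / 2 ^ Suc k) powr a) * indicator (ball (0::real^'n) (R / 2 ^ k)) x \<partial>lborel)"
      by (rule nn_integral_suminf[of "\<lambda>k x. ennreal ((R / 2 ^ Suc k) powr a) * indicator (ball (0::real^'n) (R / 2 ^ k)) x"])
        (intro borel_measurable_times_ennreal measurable_const borel_measurable_indicator, simp_all)
    also have "\<dots> = (\<Sum>k. ennreal (?c * \<theta> ^ k))"
      by (simp only: piece[OF R])
    also have "\<dots> = ennreal (\<Sum>k. ?c * \<theta> ^ k)"
      using \<theta>(1) by (intro suminf_ennreal2 sums_summable[OF s] mult_nonneg_nonneg) simp_all
    also have "(\<Sum>k. ?c * \<theta> ^ k) = ?c * (1 / (1 - \<theta>))"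
      by (rule sums_unique[OF s, symmetric])
    also have "\<dots> = C * R powr (real ?n + a)" by (simp add: C_def)
    finally show "(\<integral>\<^sup>+x. indicator (ball (0::real^'n) R) x * ennreal (power_weight a x) \<partial>lborel)
       \<le> ennreal (C * R powr (real ?n + a))" .
  qed
qed
text \<open>This explicit quantity stands for the \<open>w\<close>-measure of \<open>ball z R\<close>: the three bounds that follow say that it is an upper bound
up to a constant, that on the ball \<open>w\<close> is at least its quotient by \<open>R\<^sup>n\<close>, and that it is at most
\<open>R powr (n + a)\<close>. The first two together are the \<open>A\<^sub>1\<close> property of \<open>w\<close>.\<close>

definition ball_weight :: "real \<Rightarrow> real^'n \<Rightarrow> real \<Rightarrow> real" where
  "ball_weight a z R = R ^ CARD('n) * (norm z + R) powr a"

lemma ball_weight_pos: "R > 0 \<Longrightarrow> ball_weight a z R > 0"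
  by (auto simp: ball_weight_def intro!: mult_pos_pos) (smt (verit) norm_ge_zero)

lemma ball_weight_le:
  fixes z :: "real^'n"
  assumes "a \<le> 0" "R > 0"
  shows "ball_weight a z R \<le> R powr (real CARD('n) + a)"
proof -
  have "(norm z + R) powr a \<le> R powr a" using assms by (intro powr_mono2') auto
  then show ?thesis
    using assms by (auto simp: ball_weight_def powr_add powr_realpow)
qed

lemma power_weight_ge:
  fixes z x :: "real^'n"
  assumes "a \<le> 0" "R > 0" "x \<in> ball z R" "x \<noteq> 0"
  shows "ball_weight a z R \<le> R ^ CARD('n) * power_weight a x"
proof -
  have "norm x \<le> norm z + norm (x - z)" by (metis norm_triangle_sub)
  also have "\<dots> \<le> norm z + R" using assms by (simp add: dist_norm norm_minus_commute)
  finally have "(norm z + R) powr a \<le> norm x powr a" using assms by (intro powr_mono2') auto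
  then show ?thesis using assms by (simp add: ball_weight_def power_weight_def)
qed

lemma power_weight_nonneg: "0 \<le> power_weight a x"
  by (simp add: power_weight_def)

lemma borel_measurable_power_weight [measurable]: "power_weight a \<in> borel_measurable borel"
  unfolding power_weight_def[abs_def] by measurable

text \<open>A ball at distance at least \<open>R\<close> from the origin sees an almost constant weight. A ball closer than that lies
in the ball of radius \<open>3R\<close> about the origin, where the centred estimate applies and \<open>|z| + R\<close>
is comparable to \<open>R\<close>.\<close>

lemma nn_integral_power_weight_ball_le:
  assumes a: "- real CARD('n) < a" "a \<le> 0"
  obtains C :: real where "C > 0"
    "\<And>(z::real^'n) R. R > 0 \<Longrightarrow> (\<integral>\<^sup>+x. indicator (ball z R) x * ennreal (power_weight a x) \<partial>lborel)
       \<le> ennreal (C * ball_weight a z R)"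
proof -
  let ?n = "CARD('n)"
  obtain C0 where C0: "C0 > 0"
    "\<And>R. R > 0 \<Longrightarrow> (\<integral>\<^sup>+x. indicator (ball (0::real^'n) R) x * ennreal (power_weight a x) \<partial>lborel)
       \<le> ennreal (C0 * R powr (real ?n + a))"
    using nn_integral_power_weight_centred_ball_le[OF a] by blast
  let ?U = "unit_ball_vol (real ?n)"
  define C where "C = C0 * 3 ^ ?n + 3 powr (- a) * ?U"
  show ?thesis
  proof (rule that[of C])
    show "C > 0" unfolding C_def using C0 by (intro add_pos_pos mult_pos_pos) auto
    fix z :: "real^'n" and R :: real assume R: "R > 0"
    let ?P = "(norm z + R) powr a"
    show "(\<integral>\<^sup>+x. indicator (ball z R) x * ennreal (power_weight a x) \<partial>lborel)
       \<le> ennreal (C * ball_weight a z R)"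
    proof (cases "norm z \<ge> 2 * R")
      case True
      have pos: "(norm z + R) / 3 > 0" using R by (smt (verit) norm_ge_zero divide_pos_pos)
      have w: "power_weight a x \<le> ((norm z + R) / 3) powr a" if "x \<in> ball z R" for x
      proof -
        have "norm z \<le> norm x + norm (z - x)" by (metis norm_triangle_sub)
        with that True have "(norm z + R) / 3 \<le> norm x" by (simp add: dist_norm)
        then show ?thesis unfolding power_weight_def using pos a by (intro powr_mono2') auto
      qed
      have "(\<integral>\<^sup>+x. indicator (ball z R) x * ennreal (power_weight a x) \<partial>lborel)
        \<le> (\<integral>\<^sup>+x. ennreal (((norm z + R) / 3) powr a) * indicator (ball z R) x \<partial>lborel)"
        using w by (intro nn_integral_mono) (auto simp: indicator_def intro: ennreal_leI)
      also have "\<dots> = ennreal (((norm z + R) / 3) powr a) * ennreal (?U * R ^ ?n)"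
        using R by (subst nn_integral_cmult_indicator) (auto simp: emeasure_ball)
      also have "\<dots> = ennreal (((norm z + R) / 3) powr a * (?U * R ^ ?n))"
        by (rule ennreal_mult'[symmetric]) simp
      also have "((norm z + R) / 3) powr a * (?U * R ^ ?n) = 3 powr (- a) * ?U * (R ^ ?n * ?P)"
        using pos by (simp add: powr_divide powr_minus_divide)
      also have "\<dots> \<le> C * ball_weight a z R"
        unfolding C_def ball_weight_def using C0 R by (intro mult_right_mono) auto
      finally show ?thesis by (simp add: ennreal_leI)
    next
      case False
      have "(\<integral>\<^sup>+x. indicator (ball z R) x * ennreal (power_weight a x) \<partial>lborel)
        \<le> (\<integral>\<^sup>+x. indicator (ball (0::real^'n) (3 * R)) x * ennreal (power_weight a x) \<partial>lborel)"
      proof (intro nn_integral_mono mult_right_mono)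
        fix x
        have "norm x \<le> norm z + norm (z - x)" by (metis norm_triangle_sub norm_minus_commute)
        then show "indicator (ball z R) x \<le> (indicator (ball 0 (3 * R)) x :: ennreal)"
          using False by (auto simp: indicator_def dist_norm)
      qed simp
      also have "\<dots> \<le> ennreal (C0 * (3 * R) powr (real ?n + a))" using C0(2)[of "3 * R"] R by simp
      also have "C0 * (3 * R) powr (real ?n + a) \<le> C * ball_weight a z R"
      proof -
        have "norm z + R > 0" using R by (smt (verit) norm_ge_zero)
        then have "(3 * R) powr a \<le> ?P" using False R a by (intro powr_mono2') auto
        then have "C0 * (3 * R) powr (real ?n + a) \<le> C0 * 3 ^ ?n * (R ^ ?n * ?P)"
          using R C0 by (simp add: powr_add powr_realpow power_mult_distrib mult.assoc)
        also have "\<dots> \<le> C * (R ^ ?n * ?P)"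
          unfolding C_def using C0 R by (intro mult_right_mono) auto
        finally show ?thesis by (simp add: ball_weight_def)
      qed
      finally show ?thesis by (simp add: ennreal_leI)
    qed
  qed
qed

section \<open>Capacity and the weak-type bound\<close>

text \<open>The function \<open>f / t\<close> is admissible for the capacity of \<open>E\<close>.\<close>

lemma riesz_capacity_le:
  fixes f w :: "real^'n \<Rightarrow> real"
  assumes [measurable]: "f \<in> borel_measurable borel" "w \<in> borel_measurable borel"
    and f: "\<And>x. 0 \<le> f x" and t: "t > 0" and X: "X \<ge> 0" 
    and fX: "(\<integral>\<^sup>+x. ennreal (f x powr p * w x) \<partial>lborel) \<le> ennreal X"
    and E: "\<And>x. x \<in> E \<Longrightarrow> ennreal t \<le> riesz_potential m f x"
  shows "riesz_capacity m p w E \<le> ennreal (X / t powr p)"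
proof -
  define g where "g x = f x / t" for x
  have [measurable]: "g \<in> borel_measurable borel" unfolding g_def by measurable
  have "Lp_pow p w g = (\<integral>\<^sup>+x. ennreal (1 / t powr p) * ennreal (f x powr p * w x) \<partial>lborel)"
    unfolding Lp_pow_def nn_integral_completion
  proof (rule nn_integral_cong)
    fix x
    have "\<bar>g x\<bar> powr p * w x = 1 / t powr p * (f x powr p * w x)"
      using t f[of x] by (simp add: g_def powr_divide)
    then show "ennreal (\<bar>g x\<bar> powr p * w x) = ennreal (1 / t powr p) * ennreal (f x powr p * w x)"
      by (simp only: ennreal_mult'[of "1 / t powr p"] zero_le_divide_1_iff powr_ge_zero)
  qed
  also have "\<dots> = ennreal (1 / t powr p) * (\<integral>\<^sup>+x. ennreal (f x powr p * w x) \<partial>lborel)"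
    by (rule nn_integral_cmult) measurable
  also have "\<dots> \<le> ennreal (1 / t powr p) * ennreal X"
    using fX by (rule mult_left_mono) simp
  also have "\<dots> = ennreal (X / t powr p)"
    using X by (simp add: ennreal_mult'[symmetric])
  finally have Lp: "Lp_pow p w g \<le> ennreal (X / t powr p)" .
  have "1 \<le> riesz_potential m g x" if "x \<in> E" for x
  proof -
    have "riesz_potential m g x = (\<integral>\<^sup>+y. ennreal (1 / t) * ennreal (\<bar>f y\<bar> * norm (x - y) powr (real m - real CARD('n))) \<partial>lborel)"
      unfolding riesz_potential_def nn_integral_completion
      using t by (intro nn_integral_cong) (simp add: g_def ennreal_mult'[symmetric])
    also have "\<dots> = ennreal (1 / t) * riesz_potential m f x"
      unfolding riesz_potential_def nn_integral_completion by (rule nn_integral_cmult) measurable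
    finally have "ennreal (1 / t) * ennreal t \<le> riesz_potential m g x"
      using E[OF that] by (simp add: mult_left_mono)
    then show ?thesis using t by (simp add: ennreal_mult[symmetric])
  qed
  moreover have "g \<in> Lp_space p w"
    using Lp by (auto simp: Lp_space_def intro: measurable_completion le_less_trans)
  moreover have "AE x in lebesgue. 0 \<le> g x" using f t by (simp add: g_def)
  ultimately have "riesz_capacity m p w E \<le> Lp_pow p w g"
    unfolding riesz_capacity_def by (intro Inf_lower) auto
  from this Lp show ?thesis by (rule order_trans)
qed

lemma ennreal_powr_mono: "x \<le> y \<Longrightarrow> 0 \<le> r \<Longrightarrow> ennreal_powr x r \<le> ennreal_powr y r"
  by (auto simp: ennreal_powr_def top_unique less_top intro!: ennreal_leI powr_mono2 enn2real_mono)

text \<open>The form in which the capacity hypothesis is used: a weak-type \<open>(p, q)\<close> bound for \<open>I\<^sub>m\<close> from \<open>L\<^sup>p(w)\<close> to the measure with density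
\<open>|V|\<^sup>q w\<close>. The constant \<open>\<kappa>\<close> sits inside the power so that it scales like \<open>X\<close>.\<close>

definition weak_trace_bound :: "nat \<Rightarrow> real \<Rightarrow> real \<Rightarrow> real \<Rightarrow> real \<Rightarrow> (real^'n \<Rightarrow> real) \<Rightarrow> bool" where
  "weak_trace_bound m p q a \<kappa> V \<longleftrightarrow> (\<forall>f E X t. f \<in> borel_measurable borel \<longrightarrow> (\<forall>x. 0 \<le> f x) \<longrightarrow>
     E \<in> sets borel \<longrightarrow> X > 0 \<longrightarrow> t > 0 \<longrightarrow>
     (\<integral>\<^sup>+x. ennreal (f x powr p * power_weight a x) \<partial>lborel) \<le> ennreal X \<longrightarrow>
     (\<forall>x\<in>E. ennreal t \<le> riesz_potential m f x) \<longrightarrow>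
     (\<integral>\<^sup>+x. indicator E x * ennreal (\<bar>V x\<bar> powr q * power_weight a x) \<partial>lborel)
       \<le> ennreal ((\<kappa> * (X / t powr p)) powr (q / p)))"

lemma weak_trace_boundD:
  assumes "weak_trace_bound m p q a \<kappa> V"
    and "f \<in> borel_measurable borel" "\<And>x. 0 \<le> f x" "E \<in> sets borel" "X > 0" "t > 0"
    and "(\<integral>\<^sup>+x. ennreal (f x powr p * power_weight a x) \<partial>lborel) \<le> ennreal X"
    and "\<And>x. x \<in> E \<Longrightarrow> ennreal t \<le> riesz_potential m f x"
  shows "(\<integral>\<^sup>+x. indicator E x * ennreal (\<bar>V x\<bar> powr q * power_weight a x) \<partial>lborel)
    \<le> ennreal ((\<kappa> * (X / t powr p)) powr (q / p))"
  using assms unfolding weak_trace_bound_def by blast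

text \<open>Integrated, and with the best choice of \<open>T\<close>, this inequality replaces Hoelder's inequality up to
a constant factor.\<close>

lemma powr_le_truncation:
  fixes s T p q :: real
  assumes "0 \<le> s" "0 < T" "0 < p" "p \<le> q"
  shows "s powr p \<le> T powr p + T powr (p - q) * s powr q"
proof (cases "s \<le> T")
  case True
  then have "s powr p \<le> T powr p" using assms by (intro powr_mono2) auto
  then show ?thesis by (simp add: add_increasing2)
next
  case False
  then have "s powr (p - q) \<le> T powr (p - q)" using assms by (intro powr_mono2') auto
  then have "s powr (p - q) * s powr q \<le> T powr (p - q) * s powr q" by (intro mult_right_mono) auto
  moreover have "s powr (p - q) * s powr q = s powr p" by (simp add: powr_add[symmetric])
  ultimately show ?thesis by (simp add: add_increasing)
qed

text \<open>Hoelder's inequality between \<open>L\<^sup>q(w)\<close> and \<open>L\<^sup>p(w)\<close> on \<open>E\<close>, with a factor \<open>2\<close>. The bound for the \<open>q\<close>-th powers is taken in the form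
\<open>X powr (q/p)\<close>, as the capacity estimate provides it.\<close>

lemma nn_integral_powr_interpolation:
  fixes V w :: "'a::euclidean_space \<Rightarrow> real"
  assumes [measurable]: "V \<in> borel_measurable borel" "w \<in> borel_measurable borel" "E \<in> sets borel"
    and w: "\<And>x. 0 \<le> w x" and pq: "0 < p" "p < q" and X: "X > 0" and Y: "Y > 0"
    and VX: "(\<integral>\<^sup>+x. indicator E x * ennreal (\<bar>V x\<bar> powr q * w x) \<partial>lborel) \<le> ennreal (X powr (q / p))"
    and wY: "(\<integral>\<^sup>+x. indicator E x * ennreal (w x) \<partial>lborel) \<le> ennreal Y"
  shows "(\<integral>\<^sup>+x. indicator E x * ennreal (\<bar>V x\<bar> powr p * w x) \<partial>lborel)
    \<le> ennreal (2 * X * Y powr (1 - p / q))"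
proof -
  \<comment> \<open>The truncation height at which both terms of the splitting are equal.\<close>
  define T where "T = X powr (1 / p) * Y powr (- 1 / q)"
  have T: "T > 0" using X Y by (simp add: T_def)
  have T1: "T powr p * Y = X * Y powr (1 - p / q)"
  proof -
    have "T powr p = X * Y powr (- p / q)"
      using X Y pq by (simp add: T_def powr_mult powr_powr)
    moreover have "Y powr (1 - p / q) = Y powr (- p / q) * Y"
      using Y by (simp add: powr_diff powr_minus_divide)
    ultimately show ?thesis by simp
  qed
  have T2: "T powr (p - q) * X powr (q / p) = X * Y powr (1 - p / q)"
  proof -
    have "T powr (p - q) = X powr (1 / p * (p - q)) * Y powr (- 1 / q * (p - q))"
      using X Y by (simp only: T_def powr_mult powr_ge_zero powr_powr)
    moreover have "1 / p * (p - q) + q / p = 1" "- 1 / q * (p - q) = 1 - p / q"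
      using pq by (auto simp: field_simps)
    then have "X powr (1 / p * (p - q)) * X powr (q / p) = X" "Y powr (- 1 / q * (p - q)) = Y powr (1 - p / q)"
      using X by (simp_all only: powr_add[symmetric] powr_one)
    ultimately show ?thesis by (metis mult.assoc mult.commute)
  qed
  have "(\<integral>\<^sup>+x. indicator E x * ennreal (\<bar>V x\<bar> powr p * w x) \<partial>lborel)
    \<le> (\<integral>\<^sup>+x. ennreal (T powr p) * (indicator E x * ennreal (w x)) +
         ennreal (T powr (p - q)) * (indicator E x * ennreal (\<bar>V x\<bar> powr q * w x)) \<partial>lborel)"
  proof (intro nn_integral_mono)
    fix x
    have "\<bar>V x\<bar> powr p * w x \<le> (T powr p + T powr (p - q) * \<bar>V x\<bar> powr q) * w x"
      using powr_le_truncation[of "\<bar>V x\<bar>" T p q] T pq w by (intro mult_right_mono) auto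
    then have "ennreal (\<bar>V x\<bar> powr p * w x) \<le> ennreal (T powr p * w x + T powr (p - q) * (\<bar>V x\<bar> powr q * w x))"
      by (intro ennreal_leI) (simp add: algebra_simps)
    also have "\<dots> = ennreal (T powr p) * ennreal (w x) + ennreal (T powr (p - q)) * ennreal (\<bar>V x\<bar> powr q * w x)"
      using w by (simp add: ennreal_plus ennreal_mult)
    finally show "indicator E x * ennreal (\<bar>V x\<bar> powr p * w x) \<le> ennreal (T powr p) * (indicator E x * ennreal (w x)) +
         ennreal (T powr (p - q)) * (indicator E x * ennreal (\<bar>V x\<bar> powr q * w x))"
      by (auto simp: indicator_def)
  qed
  also have "\<dots> = ennreal (T powr p) * (\<integral>\<^sup>+x. indicator E x * ennreal (w x) \<partial>lborel) +
     ennreal (T powr (p - q)) * (\<integral>\<^sup>+x. indicator E x * ennreal (\<bar>V x\<bar> powr q * w x) \<partial>lborel)"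
    by (simp add: nn_integral_add nn_integral_cmult)
  also have "\<dots> \<le> ennreal (T powr p) * ennreal Y + ennreal (T powr (p - q)) * ennreal (X powr (q / p))"
    by (intro add_mono mult_left_mono VX wY) auto
  also have "\<dots> = ennreal (T powr p * Y + T powr (p - q) * X powr (q / p))"
    using Y by (simp add: ennreal_mult ennreal_plus)
  also have "T powr p * Y + T powr (p - q) * X powr (q / p) = 2 * X * Y powr (1 - p / q)"
    unfolding T1 T2 by simp
  finally show ?thesis .
qed

section \<open>Level sets and translated balls\<close>

lemma powr_le_dyadic_levels:
  fixes u L p :: real
  assumes L: "L > 0" and p: "p > 0" and u: "u \<ge> 0"
  shows "ennreal (u powr p) \<le> ennreal (L powr p) +
    (\<Sum>k. ennreal ((2 ^ Suc k * L) powr p) * indicator {k. 2 ^ k * L < u} k)" (is "_ \<le> _ + suminf ?g")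
proof (cases "u \<le> L")
  case True
  then have "ennreal (u powr p) \<le> ennreal (L powr p)"
    using u p by (intro ennreal_leI powr_mono2) auto
  then show ?thesis by (simp add: add_increasing2)
next
  case False
  obtain k where k: "2 ^ k * L < u" "u \<le> 2 ^ Suc k * L"
  proof -
    obtain k0 where "u / L < 2 ^ k0" using real_arch_pow[of 2 "u / L"] by auto
    then have "u \<le> 2 ^ k0 * L" using L by (simp add: field_simps)
    then obtain k where k: "u \<le> 2 ^ k * L" "\<And>j. j < k \<Longrightarrow> \<not> u \<le> 2 ^ j * L"
      using exists_least_iff[of "\<lambda>k. u \<le> 2 ^ k * L"] by blast
    with False have "k \<noteq> 0" by (intro notI) auto
    then obtain j where "k = Suc j" by (cases k) auto
    with k(1) k(2)[of j] that[of j] show ?thesis by auto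
  qed
  have "ennreal (u powr p) \<le> ennreal ((2 ^ Suc k * L) powr p)"
    using u p k(2) by (intro ennreal_leI powr_mono2) auto
  also have "\<dots> = ?g k" using k(1) by simp
  also have "?g k \<le> suminf ?g" by (rule le_suminf_ennreal)
  finally show ?thesis by (rule order_trans) simp
qed

text \<open>Integrating over all centres covers every point equally often. This replaces a covering of space by
balls with bounded overlap.\<close>

lemma nn_integral_ball_translates:
  fixes g :: "real^'n \<Rightarrow> ennreal"
  assumes [measurable]: "g \<in> borel_measurable borel" and r: "r > 0"
  shows "(\<integral>\<^sup>+z. (\<integral>\<^sup>+x. indicator (ball z r) x * g x \<partial>lborel) \<partial>lborel)
    = ennreal (unit_ball_vol (real CARD('n)) * r ^ CARD('n)) * (\<integral>\<^sup>+x. g x \<partial>lborel)"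
proof -
  have "(\<integral>\<^sup>+z. (\<integral>\<^sup>+x. indicator (ball z r) x * g x \<partial>lborel) \<partial>lborel)
    = (\<integral>\<^sup>+z. (\<integral>\<^sup>+x. indicator {x. dist z x < r} x * g x \<partial>lborel) \<partial>lborel)"
    by (simp add: ball_def)
  also have "\<dots> = (\<integral>\<^sup>+x. (\<integral>\<^sup>+z. indicator {x. dist z x < r} x * g x \<partial>lborel) \<partial>lborel)"
    unfolding indicator_def by (rule lborel_pair.Fubini'[symmetric]) measurable
  also have "\<dots> = (\<integral>\<^sup>+x. ennreal (unit_ball_vol (real CARD('n)) * r ^ CARD('n)) * g x \<partial>lborel)"
  proof (rule nn_integral_cong)
    fix x :: "real^'n"
    have "(\<integral>\<^sup>+z. indicator {x. dist z x < r} x * g x \<partial>lborel) = (\<integral>\<^sup>+z. g x * indicator (ball x r) z \<partial>lborel)"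
      by (intro nn_integral_cong) (auto simp: indicator_def dist_commute)
    also have "\<dots> = g x * ennreal (unit_ball_vol (real CARD('n)) * r ^ CARD('n))"
      using r by (subst nn_integral_cmult_indicator) (simp_all add: emeasure_ball)
    finally show "(\<integral>\<^sup>+z. indicator {x. dist z x < r} x * g x \<partial>lborel) =
      ennreal (unit_ball_vol (real CARD('n)) * r ^ CARD('n)) * g x" by (simp add: mult.commute)
  qed
  also have "\<dots> = ennreal (unit_ball_vol (real CARD('n)) * r ^ CARD('n)) * (\<integral>\<^sup>+x. g x \<partial>lborel)"
    by (rule nn_integral_cmult) measurable
  finally show ?thesis .
qed

lemma nn_integral_level_sets:
  fixes u :: "'a::euclidean_space \<Rightarrow> real" and v :: "'a \<Rightarrow> ennreal"
  assumes [measurable]: "u \<in> borel_measurable borel" "v \<in> borel_measurable borel" "B \<in> sets borel"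
    and L: "L > 0" and p: "p > 0"
  shows "(\<integral>\<^sup>+x. indicator B x * (ennreal (\<bar>u x\<bar> powr p) * v x) \<partial>lborel) \<le>
    ennreal (L powr p) * (\<integral>\<^sup>+x. indicator B x * v x \<partial>lborel) +
    (\<Sum>k. ennreal ((2 ^ Suc k * L) powr p) * (\<integral>\<^sup>+x. indicator {x\<in>B. 2 ^ k * L < \<bar>u x\<bar>} x * v x \<partial>lborel))"
proof -
  define E where "E k = {x\<in>B. 2 ^ k * L < \<bar>u x\<bar>}" for k
  have [measurable]: "E k \<in> sets borel" for k
  proof -
    have "{x \<in> space borel. x \<in> B \<and> 2 ^ k * L < \<bar>u x\<bar>} \<in> sets borel" by measurable
    then show ?thesis by (simp add: E_def)
  qed
  define c where "c k = ennreal ((2 ^ Suc k * L) powr p)" for k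
  have "(\<integral>\<^sup>+x. indicator B x * (ennreal (\<bar>u x\<bar> powr p) * v x) \<partial>lborel) \<le>
    (\<integral>\<^sup>+x. ennreal (L powr p) * (indicator B x * v x) + (\<Sum>k. c k * (indicator (E k) x * v x)) \<partial>lborel)"
  proof (intro nn_integral_mono)
    fix x
    show "indicator B x * (ennreal (\<bar>u x\<bar> powr p) * v x) \<le>
      ennreal (L powr p) * (indicator B x * v x) + (\<Sum>k. c k * (indicator (E k) x * v x))"
    proof (cases "x \<in> B")
      case True
      have "ennreal (\<bar>u x\<bar> powr p) * v x \<le>
        (ennreal (L powr p) + (\<Sum>k. c k * indicator {k. 2 ^ k * L < \<bar>u x\<bar>} k)) * v x"
        unfolding c_def by (intro mult_right_mono powr_le_dyadic_levels L p) auto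
      also have "\<dots> = ennreal (L powr p) * v x + (\<Sum>k. c k * indicator {k. 2 ^ k * L < \<bar>u x\<bar>} k * v x)"
        by (simp only: distrib_right ennreal_suminf_multc)
      also have "(\<lambda>k. c k * indicator {k. 2 ^ k * L < \<bar>u x\<bar>} k * v x) = (\<lambda>k. c k * (indicator (E k) x * v x))"
        using True by (auto simp: E_def indicator_def)
      finally show ?thesis using True by simp
    qed simp
  qed
  also have "\<dots> = ennreal (L powr p) * (\<integral>\<^sup>+x. indicator B x * v x \<partial>lborel) +
    (\<integral>\<^sup>+x. (\<Sum>k. c k * (indicator (E k) x * v x)) \<partial>lborel)"
    by (simp add: nn_integral_add nn_integral_cmult)
  also have "(\<integral>\<^sup>+x. (\<Sum>k. c k * (indicator (E k) x * v x)) \<partial>lborel) =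
    (\<Sum>k. \<integral>\<^sup>+x. c k * (indicator (E k) x * v x) \<partial>lborel)"
    by (rule nn_integral_suminf) simp
  also have "\<dots> = (\<Sum>k. c k * (\<integral>\<^sup>+x. indicator (E k) x * v x \<partial>lborel))"
    by (simp add: nn_integral_cmult)
  finally show ?thesis unfolding E_def c_def .
qed

text \<open>The mean of \<open>|u|\<close> over a ball is controlled by its \<open>L\<^sup>p(w)\<close> mean: this is the \<open>A\<^sub>1\<close> property of the weight. The number \<open>T\<close>
bounds the latter, and splitting \<open>|u|\<close> at height \<open>T\<close> makes both parts of size \<open>T\<close>.\<close>

lemma nn_integral_ball_le_powr_mean:
  fixes u :: "real^'n \<Rightarrow> real"
  assumes [measurable]: "u \<in> borel_measurable borel" and a: "a \<le> 0" and p: "p \<ge> 1" and R: "R > 0" and T: "T > 0"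
    and uT: "(\<integral>\<^sup>+x. indicator (ball z R) x * ennreal (\<bar>u x\<bar> powr p * power_weight a x) \<partial>lborel)
      \<le> ennreal (T powr p * ball_weight a z R)"
  shows "(\<integral>\<^sup>+x. indicator (ball z R) x * ennreal \<bar>u x\<bar> \<partial>lborel)
    \<le> ennreal ((unit_ball_vol (real CARD('n)) + 1) * R ^ CARD('n) * T)"
proof -
  let ?n = "CARD('n)"
  define W where "W = ball_weight a z R"
  have W: "W > 0" unfolding W_def by (rule ball_weight_pos[OF R])
  have [measurable]: "ball z R \<in> sets borel" by simp
  define c where "c = T powr (1 - p) * (R ^ ?n / W)"
  have c: "c \<ge> 0" using R W by (simp add: c_def)
  have "(\<integral>\<^sup>+x. indicator (ball z R) x * ennreal \<bar>u x\<bar> \<partial>lborel) \<le>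
    (\<integral>\<^sup>+x. ennreal T * indicator (ball z R) x +
       ennreal c * (indicator (ball z R) x * ennreal (\<bar>u x\<bar> powr p * power_weight a x)) \<partial>lborel)"
  proof (intro nn_integral_mono_AE)
    have "AE x in lborel. x \<noteq> (0::real^'n)" by (rule AE_lborel_singleton)
    then show "AE x in lborel. indicator (ball z R) x * ennreal \<bar>u x\<bar> \<le> ennreal T * indicator (ball z R) x +
       ennreal c * (indicator (ball z R) x * ennreal (\<bar>u x\<bar> powr p * power_weight a x))"
    proof eventually_elim
      fix x :: "real^'n" assume x: "x \<noteq> 0"
      show "indicator (ball z R) x * ennreal \<bar>u x\<bar> \<le> ennreal T * indicator (ball z R) x +
       ennreal c * (indicator (ball z R) x * ennreal (\<bar>u x\<bar> powr p * power_weight a x))"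
      proof (cases "x \<in> ball z R")
        case True
        have "W \<le> R ^ ?n * power_weight a x" unfolding W_def by (rule power_weight_ge[OF a R True x])
        then have "1 \<le> R ^ ?n / W * power_weight a x" using W by (simp add: field_simps)
        then have 1: "T powr (1 - p) * \<bar>u x\<bar> powr p * 1 \<le> T powr (1 - p) * \<bar>u x\<bar> powr p * (R ^ ?n / W * power_weight a x)"
          by (intro mult_left_mono) auto
        have "\<bar>u x\<bar> \<le> T + T powr (1 - p) * \<bar>u x\<bar> powr p"
          using powr_le_truncation[of "\<bar>u x\<bar>" T 1 p] T p by simp
        also have "\<dots> \<le> T + c * (\<bar>u x\<bar> powr p * power_weight a x)"
          using 1 by (simp add: c_def mult_ac)
        finally have "ennreal \<bar>u x\<bar> \<le> ennreal (T + c * (\<bar>u x\<bar> powr p * power_weight a x))" by (rule ennreal_leI)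
        also have "\<dots> = ennreal T + ennreal c * ennreal (\<bar>u x\<bar> powr p * power_weight a x)"
          using T c by (simp only: ennreal_plus ennreal_mult' mult_nonneg_nonneg powr_ge_zero power_weight_nonneg less_imp_le)
        finally show ?thesis using True by simp
      qed simp
    qed
  qed
  also have "\<dots> = ennreal T * emeasure lborel (ball z R) +
    ennreal c * (\<integral>\<^sup>+x. indicator (ball z R) x * ennreal (\<bar>u x\<bar> powr p * power_weight a x) \<partial>lborel)"
    by (simp add: nn_integral_add nn_integral_cmult nn_integral_cmult_indicator)
  also have "\<dots> \<le> ennreal T * ennreal (unit_ball_vol (real ?n) * R ^ ?n) + ennreal c * ennreal (T powr p * W)"
    using uT R unfolding W_def by (intro add_mono mult_left_mono) (simp_all add: emeasure_ball)
  also have "\<dots> = ennreal (T * (unit_ball_vol (real ?n) * R ^ ?n) + c * (T powr p * W))"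
    using T c R W by (simp add: ennreal_plus ennreal_mult)
  also have "c * (T powr p * W) = T * R ^ ?n"
  proof -
    have "T powr (1 - p) * T powr p = T" using T by (simp add: powr_add[symmetric])
    moreover have "c * (T powr p * W) = (T powr (1 - p) * T powr p) * R ^ ?n" using W by (simp add: c_def)
    ultimately show ?thesis by simp
  qed
  also have "T * (unit_ball_vol (real ?n) * R ^ ?n) + T * R ^ ?n = (unit_ball_vol (real ?n) + 1) * R ^ ?n * T"
    by (simp add: algebra_simps)
  finally show ?thesis .
qed

section \<open>The inequality on one ball\<close>

text \<open>Points of the ball are at distance at most \<open>2r\<close> from each other, and the kernel is decreasing.\<close>

lemma riesz_potential_indicator_ball_ge:
  fixes z x :: "real^'n"
  assumes r: "r > 0" and x: "x \<in> ball z r" and m: "m < CARD('n)"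
  shows "ennreal (2 powr (real m - real CARD('n)) * unit_ball_vol (real CARD('n)) * r ^ m)
    \<le> riesz_potential m (indicator (ball z r)) x"
proof -
  let ?n = "CARD('n)"
  let ?\<alpha> = "real m - real ?n"
  have "ennreal (2 powr ?\<alpha> * unit_ball_vol (real ?n) * r ^ m) = ennreal ((2 * r) powr ?\<alpha> * (unit_ball_vol (real ?n) * r ^ ?n))"
  proof -
    have "r powr ?\<alpha> * r ^ ?n = r ^ m"
      using r by (simp add: powr_realpow[symmetric] powr_add[symmetric])
    then show ?thesis using r by (simp add: powr_mult mult_ac)
  qed
  also have "\<dots> = ennreal ((2 * r) powr ?\<alpha>) * emeasure lborel (ball z r)"
    using r by (simp add: emeasure_ball ennreal_mult')
  also have "\<dots> = (\<integral>\<^sup>+y. ennreal ((2 * r) powr ?\<alpha>) * indicator (ball z r) y \<partial>lborel)"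
    by (simp add: nn_integral_cmult_indicator)
  also have "\<dots> \<le> (\<integral>\<^sup>+y. ennreal (\<bar>indicator (ball z r) y\<bar> * norm (x - y) powr ?\<alpha>) \<partial>lborel)"
  proof (rule nn_integral_mono_AE)
    have "AE y in lborel. y \<noteq> x" by (rule AE_lborel_singleton)
    then show "AE y in lborel. ennreal ((2 * r) powr ?\<alpha>) * indicator (ball z r) y \<le>
      ennreal (\<bar>indicator (ball z r) y\<bar> * norm (x - y) powr ?\<alpha>)"
    proof eventually_elim
      fix y assume y: "y \<noteq> x"
      show "ennreal ((2 * r) powr ?\<alpha>) * indicator (ball z r) y \<le>
        ennreal (\<bar>indicator (ball z r) y\<bar> * norm (x - y) powr ?\<alpha>)"
      proof (cases "y \<in> ball z r")
        case True
        have "dist x y \<le> dist z x + dist z y" by (metis dist_commute dist_triangle)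
        then have "norm (x - y) \<le> 2 * r" using True x by (simp add: dist_norm)
        then have "(2 * r) powr ?\<alpha> \<le> norm (x - y) powr ?\<alpha>" using y m by (intro powr_mono2') auto
        then show ?thesis using True by (simp add: ennreal_leI)
      qed simp
    qed
  qed
  finally show ?thesis unfolding riesz_potential_def nn_integral_completion .
qed

text \<open>Testing the weak-type bound with the indicator of \<open>ball z r\<close> shows that the capacity of the ball is at most a multiple of
\<open>r powr (-mp)\<close> times its \<open>w\<close>-measure. The estimate follows by interpolation.\<close>

lemma ball_trace_estimate:
  fixes V :: "real^'n \<Rightarrow> real"
  assumes m: "m < CARD('n)" and a: "- real CARD('n) < a" "a \<le> 0" and pq: "1 < p" "p < q" and \<kappa>: "\<kappa> > 0"
    and [measurable]: "V \<in> borel_measurable borel"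
    and trace: "weak_trace_bound m p q a \<kappa> V"
  obtains C :: real where "C > 0"
    "\<And>z r R. 0 < r \<Longrightarrow> r \<le> R \<Longrightarrow>
      (\<integral>\<^sup>+x. indicator (ball z r) x * ennreal (\<bar>V x\<bar> powr p * power_weight a x) \<partial>lborel)
        \<le> ennreal (C * r powr (- (real m * p)) * ball_weight a z R * ball_weight a z R powr (1 - p / q))"
proof -
  let ?n = "CARD('n)"
  obtain Cw where Cw: "Cw > 0" and w: "\<And>(z::real^'n) R. R > 0 \<Longrightarrow>
      (\<integral>\<^sup>+x. indicator (ball z R) x * ennreal (power_weight a x) \<partial>lborel) \<le> ennreal (Cw * ball_weight a z R)"
    using nn_integral_power_weight_ball_le[OF a] by blast
  define c where "c = 2 powr (real m - real ?n) * unit_ball_vol (real ?n)"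
  have c: "c > 0" by (simp add: c_def)
  define C where "C = 2 * (\<kappa> * Cw / c powr p) * Cw powr (1 - p / q)"
  have "C > 0" using \<kappa> Cw c by (simp add: C_def)
  then show ?thesis
  proof (rule that)
    fix z :: "real^'n" and r R :: real assume r: "0 < r" "r \<le> R"
    define W where "W = ball_weight a z R"
    have W: "W > 0" unfolding W_def using r by (intro ball_weight_pos) auto
    let ?B = "ball z r"
    have [measurable]: "?B \<in> sets borel" by simp
    define X where "X = \<kappa> * (Cw * W / (c * r ^ m) powr p)"
    have X: "X > 0" using \<kappa> Cw W c r by (simp add: X_def)
    have wB: "(\<integral>\<^sup>+x. indicator ?B x * ennreal (power_weight a x) \<partial>lborel) \<le> ennreal (Cw * W)"
    proof -
      have "(\<integral>\<^sup>+x. indicator ?B x * ennreal (power_weight a x) \<partial>lborel)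
        \<le> (\<integral>\<^sup>+x. indicator (ball z R) x * ennreal (power_weight a x) \<partial>lborel)"
        using r by (intro nn_integral_mono) (auto simp: indicator_def)
      also have "\<dots> \<le> ennreal (Cw * W)" unfolding W_def using r by (intro w) auto
      finally show ?thesis .
    qed
    have "(\<integral>\<^sup>+x. indicator ?B x * ennreal (\<bar>V x\<bar> powr q * power_weight a x) \<partial>lborel)
        \<le> ennreal (X powr (q / p))"
      unfolding X_def
    proof (rule weak_trace_boundD[OF trace])
      show "(\<integral>\<^sup>+x. ennreal (indicator ?B x powr p * power_weight a x) \<partial>lborel) \<le> ennreal (Cw * W)"
      proof -
        have "(\<integral>\<^sup>+x. ennreal (indicator ?B x powr p * power_weight a x) \<partial>lborel) =
          (\<integral>\<^sup>+x. indicator ?B x * ennreal (power_weight a x) \<partial>lborel)"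
          by (intro nn_integral_cong) (auto simp: indicator_def)
        with wB show ?thesis by simp
      qed
      show "ennreal (c * r ^ m) \<le> riesz_potential m (indicator ?B) x" if "x \<in> ?B" for x
        using riesz_potential_indicator_ball_ge[OF r(1) that m] by (simp add: c_def)
    qed (use Cw W c r in auto)
    then have "(\<integral>\<^sup>+x. indicator ?B x * ennreal (\<bar>V x\<bar> powr p * power_weight a x) \<partial>lborel)
        \<le> ennreal (2 * X * (Cw * W) powr (1 - p / q))"
      using pq X Cw W wB by (intro nn_integral_powr_interpolation) (auto simp: power_weight_nonneg)
    also have "2 * X * (Cw * W) powr (1 - p / q) = C * r powr (- (real m * p)) * W * W powr (1 - p / q)"
    proof -
      have "(c * r ^ m) powr p = c powr p * r powr (real m * p)"
        using c r by (simp add: powr_mult powr_realpow[symmetric] powr_powr)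
      then show ?thesis using c r Cw W
        by (simp add: X_def C_def powr_mult powr_minus_divide)
    qed
    finally show "(\<integral>\<^sup>+x. indicator ?B x * ennreal (\<bar>V x\<bar> powr p * power_weight a x) \<partial>lborel)
        \<le> ennreal (C * r powr (- (real m * p)) * ball_weight a z R * ball_weight a z R powr (1 - p / q))"
      unfolding W_def .
  qed
qed

text \<open>The bookkeeping behind the geometric series: on the level \<open>2\<^sup>k D T\<close> the power \<open>p\<close> of the height cancels against the
capacity bound, and the Chebyshev bound to the power \<open>\<delta> = 1 - p/q\<close> leaves the ratio \<open>2 powr (-p\<delta>)\<close>.\<close>

lemma level_coefficient_eq:
  fixes C1 D T W b S p \<delta> \<kappa> :: real and k :: nat
  assumes pos: "C1 > 0" "D > 0" "T > 0" "W > 0" "p > 0" and b: "T powr p * W = b"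
  shows "(2 ^ Suc k * (D * T)) powr p *
      (2 * (\<kappa> * (S / (2 ^ k * (D * T) / (2 * C1)) powr p)) * (b / (2 ^ k * (D * T)) powr p) powr \<delta>)
    = 2 * \<kappa> * (4 * C1) powr p * D powr (- (p * \<delta>)) * S * W powr \<delta> * (2 powr (- (p * \<delta>))) ^ k"
proof -
  define u where "u = 2 ^ k * (D * T)"
  have u: "u > 0" using pos by (simp add: u_def)
  have "2 ^ Suc k * (D * T) = 2 * u" by (simp add: u_def)
  then have 1: "(2 ^ Suc k * (D * T)) powr p = 2 powr p * u powr p"
    using u by (simp only: powr_mult less_imp_le zero_le_numeral)
  have 2: "(u / (2 * C1)) powr p = u powr p / (2 * C1) powr p"
    using u pos by (simp add: powr_divide)
  have "4 * C1 = 2 * (2 * C1)" by simp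
  then have 3: "(4 * C1) powr p = 2 powr p * (2 * C1) powr p"
    using pos by (simp only: powr_mult zero_le_numeral mult_nonneg_nonneg less_imp_le)
  define e where "e = 2 powr (p * \<delta>)"
  have e: "e > 0" by (simp add: e_def)
  have up: "u powr p = (2 ^ k) powr p * (D powr p * T powr p)"
    using pos by (simp add: u_def powr_mult)
  have ek: "((2 ^ k) powr p) powr \<delta> = e ^ k"
    by (simp add: e_def powr_realpow[symmetric] powr_powr mult_ac)
  have "b / u powr p = W / ((2 ^ k) powr p * D powr p)"
    using pos unfolding up b[symmetric] by (simp add: field_simps)
  then have "(b / u powr p) powr \<delta> = W powr \<delta> / (((2 ^ k) powr p) powr \<delta> * (D powr p) powr \<delta>)"
    using pos by (simp add: powr_divide powr_mult)
  also have "\<dots> = W powr \<delta> / (e ^ k * D powr (p * \<delta>))"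
    unfolding ek by (simp only: powr_powr)
  finally have 4: "(b / u powr p) powr \<delta> = W powr \<delta> / (e ^ k * D powr (p * \<delta>))" .
  have 5: "D powr (- (p * \<delta>)) = 1 / D powr (p * \<delta>)" "(2 powr (- (p * \<delta>))) ^ k = 1 / e ^ k"
    by (simp_all add: powr_minus_divide e_def power_one_over)
  have cancel: "A2 * U * (2 * (\<kappa> * (S / (U / A3))) * (Wd / (ek * Dd))) = 2 * \<kappa> * (A2 * A3) * (1 / Dd) * S * Wd * (1 / ek)"
    if "U > 0" for A2 A3 U Wd ek Dd :: real
    using that by (simp add: mult_ac)
  show ?thesis unfolding u_def[symmetric] 1 2 3 4 5 by (rule cancel) (use u in simp)
qed

text \<open>The heart of the argument. The height \<open>\<Lambda> = D T\<close> is a multiple of the \<open>L\<^sup>p(w)\<close> mean \<open>T\<close> of \<open>\<phi>\<close> over the larger ball, with \<open>D\<close>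
chosen so that the mean term in the Sobolev representation is at most \<open>\<Lambda>/2\<close>. On the level set of
height \<open>2\<^sup>k \<Lambda>\<close> at least half of \<open>|\<phi>|\<close> is then due to the potential of the gradient.\<close>

lemma local_interpolation_estimate:
  fixes V :: "real^'n \<Rightarrow> real"
  assumes m: "m > 0" "m < CARD('n)" and a: "- real CARD('n) < a" "a \<le> 0" and pq: "1 < p" "p < q" and \<kappa>: "\<kappa> > 0"
    and [measurable]: "V \<in> borel_measurable borel"
    and weak: "weak_trace_bound m p q a \<kappa> V"
  obtains C :: real where "C > 0"
    "\<And>\<phi> z r. all_partials_differentiable \<phi> \<Longrightarrow> r > 0 \<Longrightarrow>
      (\<integral>\<^sup>+x. indicator (ball z r) x * ennreal (\<bar>V x * \<phi> x\<bar> powr p * power_weight a x) \<partial>lborel)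
        \<le> ennreal (C * ball_weight a z ((2 * real m + 1) * r) powr (1 - p / q)) *
          ((\<integral>\<^sup>+x. indicator (ball z ((2 * real m + 1) * r)) x * ennreal (\<bar>gradient_norm m \<phi> x\<bar> powr p * power_weight a x) \<partial>lborel)
           + ennreal (r powr (- (real m * p))) *
             (\<integral>\<^sup>+x. indicator (ball z ((2 * real m + 1) * r)) x * ennreal (\<bar>\<phi> x\<bar> powr p * power_weight a x) \<partial>lborel))"
proof -
  let ?n = "CARD('n)"
  let ?w = "power_weight a :: real^'n \<Rightarrow> real"
  obtain C1 where C1: "C1 > 0" and rep: "\<And>(f :: real^'n \<Rightarrow> real) r x. all_partials_differentiable f \<Longrightarrow> r > 0 \<Longrightarrow>
      ennreal \<bar>f x\<bar> \<le>
        ennreal (C1 / r ^ ?n) * (\<integral>\<^sup>+y. indicator (ball x (2 * real m * r)) y * ennreal \<bar>f y\<bar> \<partial>lborel)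
        + ennreal C1 * (\<integral>\<^sup>+y. indicator (ball x (2 * real m * r)) y *
            ennreal (gradient_norm m f y * norm (x - y) powr (real m - real ?n)) \<partial>lborel)"
    using local_sobolev_representation[OF m] by blast
  obtain C2 where C2: "C2 > 0" and trace: "\<And>z r R. 0 < r \<Longrightarrow> r \<le> R \<Longrightarrow>
      (\<integral>\<^sup>+x. indicator (ball z r) x * ennreal (\<bar>V x\<bar> powr p * ?w x) \<partial>lborel)
        \<le> ennreal (C2 * r powr (- (real m * p)) * ball_weight a z R * ball_weight a z R powr (1 - p / q))"
    using ball_trace_estimate[OF m(2) a pq \<kappa> \<open>V \<in> borel_measurable borel\<close> weak] by blast
  define \<delta> where "\<delta> = 1 - p / q"
  have \<delta>: "\<delta> > 0" using pq by (simp add: \<delta>_def)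
  define M where "M = (2 * real m + 1)"
  have M: "M \<ge> 1" by (simp add: M_def)
  define D where "D = 2 * C1 * M ^ ?n * (unit_ball_vol (real ?n) + 1)"
  have D: "D > 0" unfolding D_def using C1 M by (intro mult_pos_pos add_nonneg_pos) auto
  define \<eta> where "\<eta> = 2 powr (- (p * \<delta>))"
  have \<eta>: "0 < \<eta>" "\<eta> < 1" using \<delta> pq by (auto simp: \<eta>_def powr_less_one)
  define G where "G = 2 * \<kappa> * (4 * C1) powr p * D powr (- (p * \<delta>))"
  have G: "G > 0" using \<kappa> C1 D by (simp add: G_def)
  define C where "C = D powr p * C2 + G / (1 - \<eta>)"
  have C: "C > 0" using D C2 G \<eta> by (simp add: C_def add_pos_pos)
  then show ?thesis
  proof (rule that, unfold M_def[symmetric] \<delta>_def[symmetric])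
    fix \<phi> :: "real^'n \<Rightarrow> real" and z :: "real^'n" and r :: real
    assume \<phi>: "all_partials_differentiable \<phi>" and r: "r > 0"
    let ?H = "gradient_norm m \<phi>"
    note [measurable] = borel_measurable_gradient_norm[OF \<phi>]
    have [measurable]: "\<phi> \<in> borel_measurable borel"
      using continuous_on_partials[OF \<phi>, of UNIV "[]"] by (auto intro: borel_measurable_continuous_onI)
    \<comment> \<open>Balls of radius \<open>2 m r\<close> about points of \<open>ball z r\<close> stay in \<open>ball z \<rho>\<close>.\<close>
    define \<rho> where "\<rho> = M * r"
    have \<rho>: "\<rho> > 0" "r \<le> \<rho>" using M r by (auto simp: \<rho>_def)
    have [measurable]: "ball z r \<in> sets borel" "ball z \<rho> \<in> sets borel" by simp_all
    define W where "W = ball_weight a z \<rho>"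
    have W: "W > 0" unfolding W_def by (rule ball_weight_pos[OF \<rho>(1)])
    define A where "A = (\<integral>\<^sup>+x. indicator (ball z \<rho>) x * ennreal (\<bar>?H x\<bar> powr p * ?w x) \<partial>lborel)"
    define P where "P = (\<integral>\<^sup>+x. indicator (ball z \<rho>) x * ennreal (\<bar>\<phi> x\<bar> powr p * ?w x) \<partial>lborel)"
    define \<theta> where "\<theta> = r powr (- (real m * p))"
    have \<theta>: "\<theta> > 0" using r by (simp add: \<theta>_def)
    let ?L = "\<integral>\<^sup>+x. indicator (ball z r) x * ennreal (\<bar>V x * \<phi> x\<bar> powr p * ?w x) \<partial>lborel"
    have split: "ennreal (\<bar>V x * \<phi> x\<bar> powr p * ?w x) = ennreal (\<bar>\<phi> x\<bar> powr p) * ennreal (\<bar>V x\<bar> powr p * ?w x)" for x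
      by (simp add: abs_mult powr_mult ennreal_mult'[symmetric] mult_ac del: ennreal_mult')
    have CW: "0 < C * W powr \<delta>" using C W by simp
    have "?L \<le> ennreal (C * W powr \<delta>) * (A + ennreal \<theta> * P)"
    proof -
      \<comment> \<open>If \<open>P = 0\<close>, then \<open>\<phi>\<close> vanishes almost everywhere on the ball; in the last case \<open>T > 0\<close>.\<close>
      consider "A = \<infinity> \<or> P = \<infinity>" | "P = 0" | al b where "A = ennreal al" "0 \<le> al" "P = ennreal b" "0 < b"
        by (cases A; cases P; force)
      then show ?thesis
      proof cases
        case 1
        have e: "A + ennreal \<theta> * P = \<infinity>" using 1 \<theta> by (auto simp: ennreal_mult_top)
        show ?thesis unfolding e using C W CW by (auto simp: ennreal_mult_top)
      next
        case 2
        then have "AE x in lborel. indicator (ball z \<rho>) x * ennreal (\<bar>\<phi> x\<bar> powr p * ?w x) = 0"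
          unfolding P_def by (subst (asm) nn_integral_0_iff_AE) auto
        then have "AE x in lborel. indicator (ball z r) x * ennreal (\<bar>V x * \<phi> x\<bar> powr p * ?w x) = 0"
        proof eventually_elim
          fix x assume "indicator (ball z \<rho>) x * ennreal (\<bar>\<phi> x\<bar> powr p * ?w x) = 0"
          then have "x \<in> ball z r \<Longrightarrow> \<phi> x = 0 \<or> ?w x = 0"
            using \<rho> power_weight_nonneg[of a x] by (auto simp: indicator_def ennreal_eq_0_iff mult_le_0_iff split: if_splits)
          then show "indicator (ball z r) x * ennreal (\<bar>V x * \<phi> x\<bar> powr p * ?w x) = 0"
            by (auto simp: indicator_def)
        qed
        then have "?L = 0" by (subst nn_integral_0_iff_AE) auto
        then show ?thesis by simp
      next
        case 3
        \<comment> \<open>Bounding both integrals by the positive number \<open>S\<close> also covers a vanishing gradient.\<close>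
        define S where "S = al + \<theta> * b"
        have S: "S > 0" using 3 \<theta> by (simp add: S_def add_nonneg_pos)
        have AS: "A + ennreal \<theta> * P = ennreal S"
          using 3 \<theta> by (simp add: S_def ennreal_mult ennreal_plus)
        have alS: "al \<le> S" and bS: "\<theta> * b \<le> S" using 3 \<theta> by (auto simp: S_def)
        define T where "T = (b / W) powr (1 / p)"
        have T: "T > 0" using 3 W by (simp add: T_def)
        have TW: "T powr p * W = b" using 3 W pq by (simp add: T_def powr_powr)
        define \<Lambda> where "\<Lambda> = D * T"
        have \<Lambda>: "\<Lambda> > 0" using D T by (simp add: \<Lambda>_def)
        have mean: "ennreal (C1 / r ^ ?n) * (\<integral>\<^sup>+x. indicator (ball z \<rho>) x * ennreal \<bar>\<phi> x\<bar> \<partial>lborel) \<le> ennreal (\<Lambda> / 2)"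
        proof -
          have "(\<integral>\<^sup>+x. indicator (ball z \<rho>) x * ennreal \<bar>\<phi> x\<bar> \<partial>lborel) \<le>
            ennreal ((unit_ball_vol (real ?n) + 1) * \<rho> ^ ?n * T)"
            using pq 3 \<rho> T a(2) TW by (intro nn_integral_ball_le_powr_mean[where p=p and a=a]) (auto simp: P_def W_def)
          then have "ennreal (C1 / r ^ ?n) * (\<integral>\<^sup>+x. indicator (ball z \<rho>) x * ennreal \<bar>\<phi> x\<bar> \<partial>lborel)
            \<le> ennreal (C1 / r ^ ?n) * ennreal ((unit_ball_vol (real ?n) + 1) * \<rho> ^ ?n * T)"
            by (rule mult_left_mono) simp
          also have "\<dots> = ennreal (C1 / r ^ ?n * ((unit_ball_vol (real ?n) + 1) * \<rho> ^ ?n * T))"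
            by (rule ennreal_mult'[symmetric]) (use C1 r in simp)
          also have "C1 / r ^ ?n * ((unit_ball_vol (real ?n) + 1) * \<rho> ^ ?n * T) = \<Lambda> / 2"
            using r by (simp add: \<Lambda>_def D_def \<rho>_def power_mult_distrib)
          finally show ?thesis .
        qed
        define E where "E k = {x \<in> ball z r. 2 ^ k * \<Lambda> < \<bar>\<phi> x\<bar>}" for k :: nat
        have [measurable]: "E k \<in> sets borel" for k
        proof -
          have "{x \<in> space borel. x \<in> ball z r \<and> 2 ^ k * \<Lambda> < \<bar>\<phi> x\<bar>} \<in> sets borel" by measurable
          then show ?thesis by (simp add: E_def)
        qed
        define f where "f x = indicator (ball z \<rho>) x * ?H x" for x
        have [measurable]: "f \<in> borel_measurable borel" unfolding f_def by measurable
        have f0: "0 \<le> f x" for x by (simp add: f_def gradient_norm_nonneg)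
        have fS: "(\<integral>\<^sup>+x. ennreal (f x powr p * ?w x) \<partial>lborel) \<le> ennreal S"
        proof -
          have "(\<integral>\<^sup>+x. ennreal (f x powr p * ?w x) \<partial>lborel) = A"
            unfolding A_def by (intro nn_integral_cong) (auto simp: f_def indicator_def gradient_norm_nonneg)
          then show ?thesis using 3 alS by (simp add: ennreal_leI)
        qed
        have potential: "ennreal (2 ^ k * \<Lambda> / (2 * C1)) \<le> riesz_potential m f x" if x: "x \<in> E k" for k x
        proof (cases "riesz_potential m f x")
          case (real pr)
          have sub: "ball x (2 * real m * r) \<subseteq> ball z \<rho>"
          proof
            fix y assume "y \<in> ball x (2 * real m * r)"
            moreover have "dist z y \<le> dist z x + dist x y" by (rule dist_triangle)
            ultimately show "y \<in> ball z \<rho>" using x by (auto simp: E_def \<rho>_def M_def algebra_simps)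
          qed
          have "ennreal \<bar>\<phi> x\<bar> \<le>
             ennreal (C1 / r ^ ?n) * (\<integral>\<^sup>+y. indicator (ball x (2 * real m * r)) y * ennreal \<bar>\<phi> y\<bar> \<partial>lborel)
             + ennreal C1 * (\<integral>\<^sup>+y. indicator (ball x (2 * real m * r)) y *
               ennreal (?H y * norm (x - y) powr (real m - real ?n)) \<partial>lborel)"
            by (rule rep[OF \<phi> r])
          also have "\<dots> \<le> ennreal (C1 / r ^ ?n) * (\<integral>\<^sup>+y. indicator (ball z \<rho>) y * ennreal \<bar>\<phi> y\<bar> \<partial>lborel)
             + ennreal C1 * riesz_potential m f x"
            unfolding riesz_potential_def nn_integral_completion
            using sub by (intro add_mono mult_left_mono nn_integral_mono)
              (auto simp: indicator_def f_def gradient_norm_nonneg)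
          also have "\<dots> \<le> ennreal (\<Lambda> / 2) + ennreal C1 * ennreal pr"
            unfolding real(2)[symmetric] by (intro add_mono mean order_refl)
          also have "\<dots> = ennreal (\<Lambda> / 2 + C1 * pr)"
            using \<Lambda> C1 real by (simp add: ennreal_plus ennreal_mult)
          finally have "\<bar>\<phi> x\<bar> \<le> \<Lambda> / 2 + C1 * pr"
            using \<Lambda> C1 real(1) by (subst (asm) ennreal_le_iff) auto
          moreover have "2 ^ k * \<Lambda> < \<bar>\<phi> x\<bar>" using x by (simp add: E_def)
          moreover have "1 * \<Lambda> \<le> 2 ^ k * \<Lambda>" using \<Lambda> by (intro mult_right_mono) auto
          ultimately have "2 ^ k * \<Lambda> / 2 \<le> C1 * pr" by simp
          then have "2 ^ k * \<Lambda> / (2 * C1) \<le> pr" using C1 by (simp add: field_simps)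
          then show ?thesis using real by (simp add: ennreal_leI)
        qed simp
        have Vq: "(\<integral>\<^sup>+x. indicator (E k) x * ennreal (\<bar>V x\<bar> powr q * ?w x) \<partial>lborel)
            \<le> ennreal ((\<kappa> * (S / (2 ^ k * \<Lambda> / (2 * C1)) powr p)) powr (q / p))" for k
          by (rule weak_trace_boundD[OF weak _ f0 _ S _ fS potential]) (use \<Lambda> C1 in auto)
        have wE: "(\<integral>\<^sup>+x. indicator (E k) x * ennreal (?w x) \<partial>lborel) \<le> ennreal (b / (2 ^ k * \<Lambda>) powr p)" for k
        proof -
          let ?u = "2 ^ k * \<Lambda>"
          have u: "?u > 0" using \<Lambda> by simp
          have "(\<integral>\<^sup>+x. indicator (E k) x * ennreal (?w x) \<partial>lborel) \<le>
            (\<integral>\<^sup>+x. ennreal (1 / ?u powr p) * (indicator (ball z \<rho>) x * ennreal (\<bar>\<phi> x\<bar> powr p * ?w x)) \<partial>lborel)"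
          proof (intro nn_integral_mono)
            fix x
            show "indicator (E k) x * ennreal (?w x) \<le> ennreal (1 / ?u powr p) * (indicator (ball z \<rho>) x * ennreal (\<bar>\<phi> x\<bar> powr p * ?w x))"
            proof (cases "x \<in> E k")
              case True
              then have x: "x \<in> ball z \<rho>" "?u < \<bar>\<phi> x\<bar>" using \<rho> by (auto simp: E_def)
              have "?u powr p \<le> \<bar>\<phi> x\<bar> powr p" using x u pq by (intro powr_mono2) auto
              then have "?u powr p * ?w x \<le> \<bar>\<phi> x\<bar> powr p * ?w x" by (rule mult_right_mono) (rule power_weight_nonneg)
              moreover have "0 < ?u powr p" using \<Lambda> by simp
              ultimately have "?w x \<le> (\<bar>\<phi> x\<bar> powr p * ?w x) / ?u powr p"
                by (simp only: pos_le_divide_eq mult.commute)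
              then have "?w x \<le> 1 / ?u powr p * (\<bar>\<phi> x\<bar> powr p * ?w x)" by simp
              then have "ennreal (?w x) \<le> ennreal (1 / ?u powr p * (\<bar>\<phi> x\<bar> powr p * ?w x))" by (rule ennreal_leI)
              also have "\<dots> = ennreal (1 / ?u powr p) * ennreal (\<bar>\<phi> x\<bar> powr p * ?w x)" by (rule ennreal_mult') simp
              finally show ?thesis using True x by simp
            qed simp
          qed
          also have "\<dots> = ennreal (1 / ?u powr p) * P" unfolding P_def by (rule nn_integral_cmult) measurable
          also have "\<dots> = ennreal (b / ?u powr p)" using 3 by (simp add: ennreal_mult'[symmetric])
          finally show ?thesis .
        qed
        have VE: "ennreal ((2 ^ Suc k * \<Lambda>) powr p) * (\<integral>\<^sup>+x. indicator (E k) x * ennreal (\<bar>V x\<bar> powr p * ?w x) \<partial>lborel)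
          \<le> ennreal (G * S * W powr \<delta> * \<eta> ^ k)" for k
        proof -
          have "(\<integral>\<^sup>+x. indicator (E k) x * ennreal (\<bar>V x\<bar> powr p * ?w x) \<partial>lborel)
            \<le> ennreal (2 * (\<kappa> * (S / (2 ^ k * \<Lambda> / (2 * C1)) powr p)) * (b / (2 ^ k * \<Lambda>) powr p) powr (1 - p / q))"
            using pq \<kappa> S \<Lambda> C1 3 Vq[of k] wE[of k]
            by (intro nn_integral_powr_interpolation) (auto simp: power_weight_nonneg)
          then have "ennreal ((2 ^ Suc k * \<Lambda>) powr p) * (\<integral>\<^sup>+x. indicator (E k) x * ennreal (\<bar>V x\<bar> powr p * ?w x) \<partial>lborel)
            \<le> ennreal ((2 ^ Suc k * \<Lambda>) powr p) * ennreal (2 * (\<kappa> * (S / (2 ^ k * \<Lambda> / (2 * C1)) powr p)) * (b / (2 ^ k * \<Lambda>) powr p) powr \<delta>)"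
            unfolding \<delta>_def by (rule mult_left_mono) simp
          also have "\<dots> = ennreal ((2 ^ Suc k * \<Lambda>) powr p * (2 * (\<kappa> * (S / (2 ^ k * \<Lambda> / (2 * C1)) powr p)) * (b / (2 ^ k * \<Lambda>) powr p) powr \<delta>))"
            by (rule ennreal_mult'[symmetric]) simp
          also have "(2 ^ Suc k * \<Lambda>) powr p * (2 * (\<kappa> * (S / (2 ^ k * \<Lambda> / (2 * C1)) powr p)) * (b / (2 ^ k * \<Lambda>) powr p) powr \<delta>)
            = G * S * W powr \<delta> * \<eta> ^ k"
            unfolding \<Lambda>_def G_def \<eta>_def using pq by (intro level_coefficient_eq C1 D T W TW) auto
          finally show ?thesis .
        qed
        have low: "ennreal (\<Lambda> powr p) * (\<integral>\<^sup>+x. indicator (ball z r) x * ennreal (\<bar>V x\<bar> powr p * ?w x) \<partial>lborel)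
          \<le> ennreal (D powr p * C2 * S * W powr \<delta>)"
        proof -
          have "ennreal (\<Lambda> powr p) * (\<integral>\<^sup>+x. indicator (ball z r) x * ennreal (\<bar>V x\<bar> powr p * ?w x) \<partial>lborel)
            \<le> ennreal (\<Lambda> powr p) * ennreal (C2 * \<theta> * W * W powr \<delta>)"
            unfolding \<theta>_def W_def \<delta>_def using trace[OF r \<rho>(2), of z] by (rule mult_left_mono) simp
          also have "\<dots> = ennreal (\<Lambda> powr p * (C2 * \<theta> * W * W powr \<delta>))"
            by (rule ennreal_mult'[symmetric]) simp
          also have "\<Lambda> powr p * (C2 * \<theta> * W * W powr \<delta>) = D powr p * C2 * (\<theta> * b) * W powr \<delta>"
            using D T unfolding \<Lambda>_def TW[symmetric] by (simp add: powr_mult)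
          also have "ennreal \<dots> \<le> ennreal (D powr p * C2 * S * W powr \<delta>)"
            using bS C2 by (intro ennreal_leI mult_right_mono mult_left_mono) auto
          finally show ?thesis .
        qed
        have s: "(\<lambda>k. G * S * W powr \<delta> * \<eta> ^ k) sums (G * S * W powr \<delta> * (1 / (1 - \<eta>)))"
          using \<eta> by (intro sums_mult[of "\<lambda>k. \<eta> ^ k"] geometric_sums) simp
        have "?L = (\<integral>\<^sup>+x. indicator (ball z r) x * (ennreal (\<bar>\<phi> x\<bar> powr p) * ennreal (\<bar>V x\<bar> powr p * ?w x)) \<partial>lborel)"
          unfolding split ..
        also have "\<dots> \<le> ennreal (\<Lambda> powr p) * (\<integral>\<^sup>+x. indicator (ball z r) x * ennreal (\<bar>V x\<bar> powr p * ?w x) \<partial>lborel) +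
          (\<Sum>k. ennreal ((2 ^ Suc k * \<Lambda>) powr p) * (\<integral>\<^sup>+x. indicator (E k) x * ennreal (\<bar>V x\<bar> powr p * ?w x) \<partial>lborel))"
          unfolding E_def using \<Lambda> pq by (intro nn_integral_level_sets) auto
        also have "\<dots> \<le> ennreal (D powr p * C2 * S * W powr \<delta>) + (\<Sum>k. ennreal (G * S * W powr \<delta> * \<eta> ^ k))"
          by (intro add_mono low suminf_le VE) auto
        also have "(\<Sum>k. ennreal (G * S * W powr \<delta> * \<eta> ^ k)) = ennreal (\<Sum>k. G * S * W powr \<delta> * \<eta> ^ k)"
          using \<eta>(1) G S by (intro suminf_ennreal2 sums_summable[OF s] mult_nonneg_nonneg) simp_all
        also have "(\<Sum>k. G * S * W powr \<delta> * \<eta> ^ k) = G * S * W powr \<delta> * (1 / (1 - \<eta>))"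
          by (rule sums_unique[OF s, symmetric])
        also have "ennreal (D powr p * C2 * S * W powr \<delta>) + ennreal (G * S * W powr \<delta> * (1 / (1 - \<eta>)))
          = ennreal (D powr p * C2 * S * W powr \<delta> + G * S * W powr \<delta> * (1 / (1 - \<eta>)))"
          using C2 S G \<eta> by (intro ennreal_plus[symmetric]) auto
        also have "D powr p * C2 * S * W powr \<delta> + G * S * W powr \<delta> * (1 / (1 - \<eta>)) = C * W powr \<delta> * S"
          by (simp add: C_def algebra_simps)
        also have "ennreal (C * W powr \<delta> * S) = ennreal (C * W powr \<delta>) * (A + ennreal \<theta> * P)"
          unfolding AS using CW by (intro ennreal_mult') simp
        finally show ?thesis .
      qed
    qed
    then show "?L \<le> ennreal (C * ball_weight a z (M * r) powr \<delta>) *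
          ((\<integral>\<^sup>+x. indicator (ball z (M * r)) x * ennreal (\<bar>?H x\<bar> powr p * ?w x) \<partial>lborel)
           + ennreal (r powr (- (real m * p))) *
             (\<integral>\<^sup>+x. indicator (ball z (M * r)) x * ennreal (\<bar>\<phi> x\<bar> powr p * ?w x) \<partial>lborel))"
      unfolding W_def A_def P_def \<theta>_def \<rho>_def .
  qed
qed

section \<open>Integration over all balls and choice of the radius\<close>

lemma borel_measurable_nn_integral_ball:
  fixes g :: "real^'n \<Rightarrow> ennreal"
  assumes [measurable]: "g \<in> borel_measurable borel"
  shows "(\<lambda>z. \<integral>\<^sup>+x. indicator (ball z r) x * g x \<partial>lborel) \<in> borel_measurable borel"
proof -
  have "(\<lambda>z. \<integral>\<^sup>+x. indicator {x. dist z x < r} x * g x \<partial>lborel) \<in> borel_measurable borel"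
    unfolding indicator_def by measurable
  then show ?thesis by (simp add: ball_def)
qed

lemma interpolation_estimate:
  fixes V :: "real^'n \<Rightarrow> real"
  assumes m: "m > 0" "m < CARD('n)" and a: "- real CARD('n) < a" "a \<le> 0" and pq: "1 < p" "p < q" and \<kappa>: "\<kappa> > 0"
    and [measurable]: "V \<in> borel_measurable borel"
    and trace: "weak_trace_bound m p q a \<kappa> V"
  obtains C :: real where "C > 0"
    "\<And>\<phi> r. all_partials_differentiable \<phi> \<Longrightarrow> r > 0 \<Longrightarrow>
      Lp_pow p (power_weight a) (\<lambda>x. V x * \<phi> x)
        \<le> ennreal (C * r powr ((real CARD('n) + a) * (1 - p / q))) *
          (Lp_pow p (power_weight a) (gradient_norm m \<phi>) + ennreal (r powr (- (real m * p))) * Lp_pow p (power_weight a) \<phi>)"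
proof -
  let ?n = "CARD('n)"
  let ?U = "unit_ball_vol (real ?n)"
  define M where "M = 2 * real m + 1"
  have M: "M > 0" by (simp add: M_def)
  define \<delta> where "\<delta> = 1 - p / q"
  have \<delta>: "\<delta> > 0" using pq by (simp add: \<delta>_def)
  obtain C where C: "C > 0" and loc: "\<And>\<phi> z r. all_partials_differentiable \<phi> \<Longrightarrow> r > 0 \<Longrightarrow>
      (\<integral>\<^sup>+x. indicator (ball z r) x * ennreal (\<bar>V x * \<phi> x\<bar> powr p * power_weight a x) \<partial>lborel)
        \<le> ennreal (C * ball_weight a z (M * r) powr \<delta>) *
          ((\<integral>\<^sup>+x. indicator (ball z (M * r)) x * ennreal (\<bar>gradient_norm m \<phi> x\<bar> powr p * power_weight a x) \<partial>lborel)
           + ennreal (r powr (- (real m * p))) *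
             (\<integral>\<^sup>+x. indicator (ball z (M * r)) x * ennreal (\<bar>\<phi> x\<bar> powr p * power_weight a x) \<partial>lborel))"
    unfolding M_def \<delta>_def
    using local_interpolation_estimate[OF m a pq \<kappa> \<open>V \<in> borel_measurable borel\<close> trace] by blast
  define C' where "C' = C * M powr ((real ?n + a) * \<delta>) * M ^ ?n"
  have "C' > 0" using C M by (simp add: C'_def)
  then show ?thesis
  proof (rule that, unfold \<delta>_def[symmetric])
    fix \<phi> :: "real^'n \<Rightarrow> real" and r :: real
    assume \<phi>: "all_partials_differentiable \<phi>" and r: "r > 0"
    note [measurable] = borel_measurable_gradient_norm[OF \<phi>]
    have [measurable]: "\<phi> \<in> borel_measurable borel"
      using continuous_on_partials[OF \<phi>, of UNIV "[]"] by (auto intro: borel_measurable_continuous_onI)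
    define v0 v1 v2 where "v0 x = ennreal (\<bar>V x * \<phi> x\<bar> powr p * power_weight a x)"
      and "v1 x = ennreal (\<bar>gradient_norm m \<phi> x\<bar> powr p * power_weight a x)"
      and "v2 x = ennreal (\<bar>\<phi> x\<bar> powr p * power_weight a x)" for x
    have [measurable]: "v0 \<in> borel_measurable borel" "v1 \<in> borel_measurable borel" "v2 \<in> borel_measurable borel"
      unfolding v0_def v1_def v2_def by measurable
    note [measurable] = borel_measurable_nn_integral_ball
    define \<theta> where "\<theta> = r powr (- (real m * p))"
    define \<rho> where "\<rho> = M * r"
    have \<rho>: "\<rho> > 0" using M r by (simp add: \<rho>_def)
    define \<gamma> where "\<gamma> = (real ?n + a) * \<delta>"
    let ?b = "\<lambda>v z s. \<integral>\<^sup>+x. indicator (ball z s) x * v x \<partial>lborel"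
    let ?I = "\<lambda>v. \<integral>\<^sup>+x. v x \<partial>lborel"
    have "ennreal (?U * r ^ ?n) * ?I v0 = (\<integral>\<^sup>+z. ?b v0 z r \<partial>lborel)"
      by (rule nn_integral_ball_translates[symmetric]) (use r in auto)
    also have "\<dots> \<le> (\<integral>\<^sup>+z. ennreal (C * \<rho> powr \<gamma>) * (?b v1 z \<rho> + ennreal \<theta> * ?b v2 z \<rho>) \<partial>lborel)"
    proof (rule nn_integral_mono)
      fix z :: "real^'n"
      have "?b v0 z r \<le> ennreal (C * ball_weight a z \<rho> powr \<delta>) * (?b v1 z \<rho> + ennreal \<theta> * ?b v2 z \<rho>)"
        unfolding v0_def v1_def v2_def \<rho>_def \<theta>_def by (rule loc[OF \<phi> r])
      also have "\<dots> \<le> ennreal (C * \<rho> powr \<gamma>) * (?b v1 z \<rho> + ennreal \<theta> * ?b v2 z \<rho>)"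
      proof (intro mult_right_mono ennreal_leI mult_left_mono)
        have "ball_weight a z \<rho> powr \<delta> \<le> (\<rho> powr (real ?n + a)) powr \<delta>"
          using ball_weight_le[OF a(2) \<rho>] ball_weight_pos[OF \<rho>, of a z] \<delta> by (intro powr_mono2) auto
        then show "ball_weight a z \<rho> powr \<delta> \<le> \<rho> powr \<gamma>" by (simp add: \<gamma>_def powr_powr)
      qed (use C in auto)
      finally show "?b v0 z r \<le> ennreal (C * \<rho> powr \<gamma>) * (?b v1 z \<rho> + ennreal \<theta> * ?b v2 z \<rho>)" .
    qed
    also have "\<dots> = ennreal (C * \<rho> powr \<gamma>) * ((\<integral>\<^sup>+z. ?b v1 z \<rho> \<partial>lborel) + ennreal \<theta> * (\<integral>\<^sup>+z. ?b v2 z \<rho> \<partial>lborel))"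
      by (simp add: nn_integral_cmult nn_integral_add)
    also have "\<dots> = ennreal (C * \<rho> powr \<gamma>) * (ennreal (?U * \<rho> ^ ?n) * ?I v1 + ennreal \<theta> * (ennreal (?U * \<rho> ^ ?n) * ?I v2))"
      using \<rho> by (simp only: nn_integral_ball_translates \<open>v1 \<in> borel_measurable borel\<close> \<open>v2 \<in> borel_measurable borel\<close>)
    also have "\<dots> = ennreal (C * \<rho> powr \<gamma>) * ennreal (?U * \<rho> ^ ?n) * (?I v1 + ennreal \<theta> * ?I v2)"
      by (simp only: distrib_left mult_ac)
    also have "ennreal (C * \<rho> powr \<gamma>) * ennreal (?U * \<rho> ^ ?n) = ennreal (?U * r ^ ?n) * ennreal (C' * r powr \<gamma>)"
    proof -
      have "C * \<rho> powr \<gamma> * (?U * \<rho> ^ ?n) = ?U * r ^ ?n * (C' * r powr \<gamma>)"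
        using M r by (simp add: \<rho>_def C'_def \<gamma>_def powr_mult power_mult_distrib)
      moreover have "ennreal (C * \<rho> powr \<gamma>) * ennreal (?U * \<rho> ^ ?n) = ennreal (C * \<rho> powr \<gamma> * (?U * \<rho> ^ ?n))"
        by (rule ennreal_mult'[symmetric]) (use C in simp)
      moreover have "ennreal (?U * r ^ ?n) * ennreal (C' * r powr \<gamma>) = ennreal (?U * r ^ ?n * (C' * r powr \<gamma>))"
        by (rule ennreal_mult'[symmetric]) (use r in simp)
      ultimately show ?thesis by (simp only:)
    qed
    finally have "ennreal (?U * r ^ ?n) * ?I v0 \<le> ennreal (?U * r ^ ?n) * (ennreal (C' * r powr \<gamma>) * (?I v1 + ennreal \<theta> * ?I v2))"
      by (simp only: mult.assoc)
    moreover have "ennreal (?U * r ^ ?n) \<noteq> 0" using r by (simp add: ennreal_eq_0_iff not_le)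
    ultimately have "?I v0 \<le> ennreal (C' * r powr \<gamma>) * (?I v1 + ennreal \<theta> * ?I v2)"
      by (simp only: ennreal_mult_le_mult_iff ennreal_neq_top not_False_eq_True)
    then show "Lp_pow p (power_weight a) (\<lambda>x. V x * \<phi> x)
        \<le> ennreal (C' * r powr ((real ?n + a) * \<delta>)) *
          (Lp_pow p (power_weight a) (gradient_norm m \<phi>) + ennreal (r powr (- (real m * p))) * Lp_pow p (power_weight a) \<phi>)"
      unfolding Lp_pow_def nn_integral_completion v0_def v1_def v2_def \<theta>_def \<gamma>_def .
  qed
qed

theorem corollary1p6:
  fixes \<beta> a p q K :: real and m :: nat and w V :: "real^'n \<Rightarrow> real"
    and v :: "(real^'n) measure"
  assumes "\<beta> > 0"
    and "m > 0" and "m < CARD('n)"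
    and "1 - real CARD('n) < a" and "a \<le> 0"
    and "1 < p" and "p < (\<beta> + 1) * (real CARD('n) + a) / real m"
    and "1 / p - 1 / q = real m / ((\<beta> + 1) * (real CARD('n) + a))"
    and "w = power_weight a"
    and "V \<in> Lp_space q w" and "AE x in lebesgue. 0 \<le> V x"
    and "v = density lebesgue (\<lambda>x. ennreal (\<bar>V x\<bar> powr q * w x))"
    and "K > 0"
    and "\<And>E. E \<in> sets lebesgue \<Longrightarrow>
           emeasure v E \<le> ennreal K * ennreal_powr (riesz_capacity m p w E) (q / p)"
  shows "\<exists>C>0. \<forall>\<epsilon>>0. \<forall>\<phi>\<in>smooth_compact_support.
           Lp_pow p w (\<lambda>x. V x * \<phi> x)
             \<le> ennreal \<epsilon> * Lp_pow p w (gradient_norm m \<phi>)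
               + ennreal (C * \<epsilon> powr (- \<beta>)) * Lp_pow p w \<phi>"
proof -
  note \<beta> = assms(1) and m = assms(2,3) and a0 = assms(5) and p1 = assms(6) and w = assms(9) and K = assms(13)
  let ?n = "CARD('n)"
  define N where "N = real ?n + a"
  have N: "N > 1" using assms(4) by (simp add: N_def)
  have a: "- real ?n < a" "a \<le> 0" using assms(4,5) by auto
  have s: "real m / ((\<beta> + 1) * N) > 0" using m \<beta> N by simp
  have "real m * p < (\<beta> + 1) * N"
    using assms(7) m by (simp add: N_def pos_less_divide_eq mult.commute)
  moreover have X: "(\<beta> + 1) * N > 0" using \<beta> N by simp
  ultimately have "real m / ((\<beta> + 1) * N) < 1 / p"
    using p1 by (simp only: pos_divide_less_eq[OF X]) (simp add: pos_less_divide_eq)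
  then have "1 / q > 0" using assms(8) unfolding N_def by linarith
  then have q0: "q > 0" by simp
  have "1 / q < 1 / p" using assms(8) s unfolding N_def by linarith
  then have pq: "p < q" using q0 p1 by (simp add: field_simps)
  have \<gamma>_eq: "N * (1 - p / q) = real m * p / (\<beta> + 1)"
  proof -
    have "1 - p / q = p * (1 / p - 1 / q)" using p1 q0 by (simp add: field_simps)
    also have "\<dots> = p * (real m / ((\<beta> + 1) * N))" using assms(8) by (simp add: N_def)
    finally show ?thesis using N \<beta> by simp
  qed
  have V_meas: "V \<in> borel_measurable lebesgue" using assms(10) by (simp add: Lp_space_def)
  obtain V' where V'[measurable]: "V' \<in> borel_measurable lborel" and VV': "AE x in lborel. V x = V' x"
    using completion_ex_borel_measurable_real[OF V_meas] by auto
  have V'b: "V' \<in> borel_measurable borel" using V' by simp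
  define \<kappa> where "\<kappa> = K powr (p / q)"
  have \<kappa>: "\<kappa> > 0" using K by (simp add: \<kappa>_def)
  \<comment> \<open>With a Borel version \<open>V'\<close> of \<open>V\<close> every integrand is Borel, as Tonelli's theorem for \<open>lborel\<close> asks.\<close>
  have cap: "(\<integral>\<^sup>+x. indicator E x * ennreal (\<bar>V' x\<bar> powr q * power_weight a x) \<partial>lborel)
        \<le> ennreal ((\<kappa> * (X / t powr p)) powr (q / p))"
    if "f \<in> borel_measurable borel" "\<And>x. 0 \<le> f x" "E \<in> sets borel" "X > 0" "t > 0"
      "(\<integral>\<^sup>+x. ennreal (f x powr p * power_weight a x) \<partial>lborel) \<le> ennreal X"
      "\<And>x. x \<in> E \<Longrightarrow> ennreal t \<le> riesz_potential m f x" for f and E :: "(real^'n) set" and X t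
  proof -
    define Y where "Y = X / t powr p"
    have Y: "Y > 0" using that by (simp add: Y_def)
    have E: "E \<in> sets lebesgue" using that(3) by simp
    have wm: "power_weight a \<in> borel_measurable (lebesgue :: (real^'n) measure)"
      by (intro measurable_completion) simp
    have "(\<integral>\<^sup>+x. indicator E x * ennreal (\<bar>V' x\<bar> powr q * power_weight a x) \<partial>lborel)
      = (\<integral>\<^sup>+x. ennreal (\<bar>V x\<bar> powr q * power_weight a x) * indicator E x \<partial>lborel)"
    proof (rule nn_integral_cong_AE)
      show "AE x in lborel. indicator E x * ennreal (\<bar>V' x\<bar> powr q * power_weight a x)
        = ennreal (\<bar>V x\<bar> powr q * power_weight a x) * indicator E x"
        using VV' by eventually_elim (simp add: mult.commute)
    qed
    also have "\<dots> = emeasure v E"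
      unfolding assms(12) w using V_meas wm E
      by (subst emeasure_density) (auto simp: nn_integral_completion)
    also have "\<dots> \<le> ennreal K * ennreal_powr (riesz_capacity m p w E) (q / p)"
      by (rule assms(14)[OF E])
    also have "\<dots> \<le> ennreal K * ennreal_powr (ennreal Y) (q / p)"
      unfolding Y_def w using that p1 q0
      by (intro mult_left_mono ennreal_powr_mono riesz_capacity_le[where f=f]) auto
    also have "\<dots> = ennreal (K * Y powr (q / p))"
      using Y K by (simp add: ennreal_powr_def ennreal_mult')
    also have "K * Y powr (q / p) = (\<kappa> * Y) powr (q / p)"
      using K Y p1 q0 by (simp add: \<kappa>_def powr_mult powr_powr)
    finally show ?thesis unfolding Y_def .
  qed
  then have trace: "weak_trace_bound m p q a \<kappa> V'"
    unfolding weak_trace_bound_def by blast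
  obtain C where C: "C > 0" and est: "\<And>\<phi> r. all_partials_differentiable \<phi> \<Longrightarrow> r > 0 \<Longrightarrow>
      Lp_pow p (power_weight a) (\<lambda>x. V' x * \<phi> x)
        \<le> ennreal (C * r powr (N * (1 - p / q))) *
          (Lp_pow p (power_weight a) (gradient_norm m \<phi>) + ennreal (r powr (- (real m * p))) * Lp_pow p (power_weight a) \<phi>)"
    unfolding N_def
    using interpolation_estimate[OF m a p1 pq \<kappa> V'b trace] by blast
  show ?thesis
  proof (intro exI[of _ "C powr (\<beta> + 1)"] conjI allI impI ballI)
    show "0 < C powr (\<beta> + 1)" using C by simp
    fix \<epsilon> :: real and \<phi> :: "real^'n \<Rightarrow> real"
    assume \<epsilon>: "\<epsilon> > 0" and "\<phi> \<in> smooth_compact_support"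
    then have \<phi>: "all_partials_differentiable \<phi>"
      by (simp add: smooth_compact_support_def all_partials_differentiable_def)
    define \<gamma> where "\<gamma> = real m * p / (\<beta> + 1)"
    have \<gamma>: "\<gamma> > 0" using m p1 \<beta> by (simp add: \<gamma>_def)
    \<comment> \<open>The radius at which the coefficient of the gradient term is exactly \<open>\<epsilon>\<close>.\<close>
    define r where "r = (\<epsilon> / C) powr (1 / \<gamma>)"
    have r: "r > 0" using \<epsilon> C by (simp add: r_def)
    have 1: "C * r powr \<gamma> = \<epsilon>" using \<epsilon> C \<gamma> by (simp add: r_def powr_powr)
    have 2: "\<epsilon> * r powr (- (real m * p)) = C powr (\<beta> + 1) * \<epsilon> powr (- \<beta>)"
    proof -
      have "1 / \<gamma> * (- (real m * p)) = - (\<beta> + 1)" using m p1 \<beta> by (simp add: \<gamma>_def)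
      then have "r powr (- (real m * p)) = (\<epsilon> / C) powr (- (\<beta> + 1))"
        unfolding r_def powr_powr by (simp only:)
      also have "\<dots> = C powr (\<beta> + 1) * \<epsilon> powr (- \<beta> - 1)"
        using \<epsilon> C by (simp add: powr_divide powr_minus_divide powr_diff powr_add)
      also have "\<epsilon> powr (- \<beta> - 1) = \<epsilon> powr (- \<beta>) / \<epsilon>" using \<epsilon> by (simp add: powr_diff)
      finally show ?thesis using \<epsilon> by simp
    qed
    have "Lp_pow p w (\<lambda>x. V x * \<phi> x) = Lp_pow p w (\<lambda>x. V' x * \<phi> x)"
      unfolding Lp_pow_def nn_integral_completion
      by (rule nn_integral_cong_AE) (use VV' in eventually_elim, simp)
    also have "\<dots> \<le> ennreal \<epsilon> * (Lp_pow p w (gradient_norm m \<phi>) + ennreal (r powr (- (real m * p))) * Lp_pow p w \<phi>)"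
      using est[OF \<phi> r] unfolding \<gamma>_eq \<gamma>_def[symmetric] 1 w .
    also have "\<dots> = ennreal \<epsilon> * Lp_pow p w (gradient_norm m \<phi>) + ennreal (\<epsilon> * r powr (- (real m * p))) * Lp_pow p w \<phi>"
      using \<epsilon> by (simp add: distrib_left ennreal_mult' mult.assoc)
    finally show "Lp_pow p w (\<lambda>x. V x * \<phi> x) \<le> ennreal \<epsilon> * Lp_pow p w (gradient_norm m \<phi>)
               + ennreal (C powr (\<beta> + 1) * \<epsilon> powr (- \<beta>)) * Lp_pow p w \<phi>"
      unfolding 2 .
  qed
qed

end
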